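(* For any $(t,\mathbf{x})\in\mathbb{T}\times\mathbb{S}^{\mathbb{T}}$ and any $\mathbb{F}$-stopping time $\tau$ with $\tau(\mathbf{x})>t$, $$\mathbb{V}(t,\mathbf{x})=\Big\{J(\tau,\psi;t,\mathbf{x},\alpha^* ):\ \psi:\mathbb{S}^{\mathbb{T}}\to\mathbb{R}^N\ \mathcal{F}_\tau\text{-measurable with }\psi(\tilde{\mathbf{x}})\in\mathbb{V}(\tau(\tilde{\mathbf{x}}),\tilde{\mathbf{x}})\ \ \forall\tilde{\mathbf{x}}\in\mathbb{S}^{\mathbb{T}}_{t,\mathbf{x}},\ \text{and }\alpha^*\in NE(\tau,\psi;t,\mathbf{x})\Big\}.$$
   Context: Discrete-time game. $\mathbb{T}=\{0,1,\dots,T\}$; for each $t\in\mathbb{T}$, $\mathbb{S}_t$ is a (nonempty) finite set of states. $\mathbb{S}^{\mathbb{T}}=\{\mathbf{x}=(\mathbf{x}_0,\dots,\mathbf{x}_T):\mathbf{x}_t\in\mathbb{S}_t,\ t\in\mathbb{T}\}$ is the path space (the sample space), $X_t(\mathbf{x})=\mathbf{x}_t$ the canonical process, $\mathbb{F}=\{\mathcal{F}_t\}$ the filtration generated by $X$. A function $\varphi$ of time and path is adapted if $\varphi(t,\mathbf{x})$ depends only on $(t,\mathbf{x}_0,\dots,\mathbf{x}_t)$; all time dependent functions below are adapted. Write $\mathbf{x}=_t\tilde{\mathbf{x}}$ if $\mathbf{x}_s=\tilde{\mathbf{x}}_s$ for $s=0,\dots,t$, and $\mathbb{S}^{\mathbb{T}}_{t,\mathbf{x}}=\{\tilde{\mathbf{x}}\in\mathbb{S}^{\mathbb{T}}:\tilde{\mathbf{x}}=_t\mathbf{x}\}$.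 There are $N$ players. Player $i$'s control values lie in a Borel measurable set $A_i$ in some topological space; $A=A_1\times\cdots\times A_N$. $\mathcal{A}_i$ is the set of adapted maps $\alpha_i:\mathbb{T}\times\mathbb{S}^{\mathbb{T}}\to A_i$, $\mathcal{A}=\mathcal{A}_1\times\cdots\times\mathcal{A}_N$. For each $(t,\mathbf{x},a)$ (with $t<T$), $q(t,\mathbf{x},a;\cdot):\mathbb{S}_{t+1}\to(0,1]$ is a (strictly positive, adapted) transition probability: $\sum_{x\in\mathbb{S}_{t+1}}q(t,\mathbf{x},a;x)=1$. For $\alpha\in\mathcal{A}$, $\mathbb{P}^{t,\mathbf{x},\alpha}$ is the probability on $\mathbb{S}^{\mathbb{T}}$ with $\mathbb{P}^{t,\mathbf{x},\alpha}(X=_t\mathbf{x})=1$ and $\mathbb{P}^{t,\mathbf{x},\alpha}(X_{s+1}=x\mid X=_s\tilde{\mathbf{x}})=q(s,\tilde{\mathbf{x}},\alpha(s,\tilde{\mathbf{x}});x)$ for all $s\ge t$, $\tilde{\mathbf{x}}\in\mathbb{S}^{\mathbb{T}}_{t,\mathbf{x}}$, $x\in\mathbb{S}_{s+1}$. For $i=1,\dots,N$, $g_i:\mathbb{S}^{\mathbb{T}}\to\mathbb{R}$ and $f_i:\mathbb{T}\times\mathbb{S}^{\mathbb{T}}\times A_i\to\mathbb{R}$ is adapted and measurable in $a_i$. Costs: $J_i(t,\mathbf{x},\alpha)=\mathbb{E}^{\mathbb{P}^{t,\mathbf{x},\alpha}}\big[g_i(X)+\sum_{s=t}^{T-1}f_i(s,X,\alpha_i(s,X))\big]$,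 $J=(J_1,\dots,J_N)$. For $\alpha^*\in\mathcal{A}$ and $\alpha_i\in\mathcal{A}_i$, $(\alpha^{*,-i},\alpha_i)$ is $\alpha^*$ with $i$-th component replaced by $\alpha_i$. $\alpha^*\in\mathcal{A}$ is a Nash equilibrium at $(t,\mathbf{x})$, written $\alpha^*\in NE(t,\mathbf{x})$, if $J_i(t,\mathbf{x},\alpha^* )\le J_i(t,\mathbf{x},\alpha^{*,-i},\alpha_i)$ for all $i$ and all $\alpha_i\in\mathcal{A}_i$. The set value is $\mathbb{V}(t,\mathbf{x})=\{J(t,\mathbf{x},\alpha^* ):\alpha^*\in NE(t,\mathbf{x})\}\subset\mathbb{R}^N$. Given a ($\mathbb{T}$-valued) $\mathbb{F}$-stopping time $\tau$ and an $\mathcal{F}_\tau$-measurable $\psi:\mathbb{S}^{\mathbb{T}}\to\mathbb{R}^N$ (i.e. $\psi(\mathbf{x})$ depends only on the path $\mathbf{x}$ stopped at $\tau(\mathbf{x})$), set $J_i(\tau,\psi;t,\mathbf{x},\alpha)=\mathbb{E}^{\mathbb{P}^{t,\mathbf{x},\alpha}}\big[\psi_i(X)+\sum_{s=t}^{\tau-1}f_i(s,X,\alpha_i(s,X))\big]$, $J(\tau,\psi;\cdot)=(J_1(\tau,\psi;\cdot),\dots,J_N(\tau,\psi;\cdot))$. $NE(\tau,\psi;t,\mathbf{x})$ is the set of $\alpha^*\in\mathcal{A}$ with $J_i(\tau,\psi;t,\mathbf{x},\alpha^* )\le J_i(\tau,\psi;t,\mathbf{x},\alpha^{*,-i},\alpha_i)$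 for all $i$ and all $\alpha_i\in\mathcal{A}_i$. *)

theory Defs
  imports "HOL-Probability.Probability"
begin

text \<open>
  Players are the elements of the finite type \<^typ>\<open>'n\<close>, so that values live in
  \<^typ>\<open>real ^ 'n\<close>. The state sets of different times and the control spaces of different players
  are merely required to sit inside common universes \<^typ>\<open>'s\<close> and \<^typ>\<open>'a\<close>; each player has a
  topology of his own, so genuinely different spaces are covered by passing to a sum type.
\<close>

record ('s, 'a, 'n) game =
  horizon :: nat
  states :: "nat \<Rightarrow> 's set"
  ctrl_top :: "'n \<Rightarrow> 'a topology"
  ctrl_vals :: "'n \<Rightarrow> 'a set"
  trans_prob :: "nat \<Rightarrow> (nat \<Rightarrow> 's) \<Rightarrow> ('n \<Rightarrow> 'a) \<Rightarrow> 's \<Rightarrow> real"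
  term_cost :: "'n \<Rightarrow> (nat \<Rightarrow> 's) \<Rightarrow> real"
  run_cost :: "'n \<Rightarrow> nat \<Rightarrow> (nat \<Rightarrow> 's) \<Rightarrow> 'a \<Rightarrow> real"

definition time_set :: "('s, 'a, 'n) game \<Rightarrow> nat set" where
  "time_set G = {0..horizon G}"

definition paths :: "('s, 'a, 'n) game \<Rightarrow> (nat \<Rightarrow> 's) set" where
  "paths G = (\<Pi>\<^sub>E t\<in>time_set G. states G t)"

definition agree :: "nat \<Rightarrow> (nat \<Rightarrow> 's) \<Rightarrow> (nat \<Rightarrow> 's) \<Rightarrow> bool" where
  "agree t x y \<longleftrightarrow> (\<forall>s\<le>t. x s = y s)"

definition paths_from :: "('s, 'a, 'n) game \<Rightarrow> nat \<Rightarrow> (nat \<Rightarrow> 's) \<Rightarrow> (nat \<Rightarrow> 's) set" where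
  "paths_from G t x = {y \<in> paths G. agree t y x}"

definition adapted :: "('s, 'a, 'n) game \<Rightarrow> (nat \<Rightarrow> (nat \<Rightarrow> 's) \<Rightarrow> 'b) \<Rightarrow> bool" where
  "adapted G \<phi> \<longleftrightarrow>
     (\<forall>t\<in>time_set G. \<forall>x\<in>paths G. \<forall>y\<in>paths G. agree t x y \<longrightarrow> \<phi> t x = \<phi> t y)"

definition borel_of_top :: "'a topology \<Rightarrow> 'a measure" where
  "borel_of_top X = sigma (topspace X) {U. openin X U}"

text \<open>
  Transition probabilities only matter for times before the horizon, control profiles in the product
  of the control sets and target states in the next state set; hence adaptedness of
  \<^const>\<open>trans_prob\<close> is spelled out on that domain instead of using \<^const>\<open>adapted\<close>.
\<close>

definition is_game :: "('s, 'a, 'n::finite) game \<Rightarrow> bool" where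
  "is_game G \<longleftrightarrow>
     (\<forall>t\<in>time_set G. finite (states G t) \<and> states G t \<noteq> {}) \<and>
     (\<forall>i. ctrl_vals G i \<in> sets (borel_of_top (ctrl_top G i))) \<and>
     (\<forall>t<horizon G. \<forall>a\<in>(\<Pi> i\<in>UNIV. ctrl_vals G i).
        (\<forall>x\<in>paths G. (\<forall>z\<in>states G (Suc t). trans_prob G t x a z \<in> {0<..1}) \<and>
                      (\<Sum>z\<in>states G (Suc t). trans_prob G t x a z) = 1) \<and>
        (\<forall>x\<in>paths G. \<forall>y\<in>paths G. agree t x y \<longrightarrow>
           (\<forall>z\<in>states G (Suc t). trans_prob G t x a z = trans_prob G t y a z))) \<and>
     (\<forall>i. \<forall>a\<in>ctrl_vals G i. adapted G (\<lambda>t x. run_cost G i t x a)) \<and>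
     (\<forall>i. \<forall>t\<in>time_set G. \<forall>x\<in>paths G.
        run_cost G i t x \<in> borel_measurable
          (restrict_space (borel_of_top (ctrl_top G i)) (ctrl_vals G i)))"

definition player_controls ::
    "('s, 'a, 'n) game \<Rightarrow> 'n \<Rightarrow> (nat \<Rightarrow> (nat \<Rightarrow> 's) \<Rightarrow> 'a) set" where
  "player_controls G i =
     {\<beta>. adapted G \<beta> \<and> (\<forall>t\<in>time_set G. \<forall>x\<in>paths G. \<beta> t x \<in> ctrl_vals G i)}"

definition controls :: "('s, 'a, 'n) game \<Rightarrow> ('n \<Rightarrow> nat \<Rightarrow> (nat \<Rightarrow> 's) \<Rightarrow> 'a) set" where
  "controls G = (\<Pi> i\<in>UNIV. player_controls G i)"


section \<open>The controlled law of the canonical process\<close>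

definition is_law :: "('s, 'a, 'n) game \<Rightarrow> nat \<Rightarrow> (nat \<Rightarrow> 's) \<Rightarrow>
    ('n \<Rightarrow> nat \<Rightarrow> (nat \<Rightarrow> 's) \<Rightarrow> 'a) \<Rightarrow> (nat \<Rightarrow> 's) pmf \<Rightarrow> bool" where
  "is_law G t x \<alpha> P \<longleftrightarrow>
     set_pmf P \<subseteq> paths G \<and>
     \<P>(X in measure_pmf P. agree t X x) = 1 \<and>
     (\<forall>s\<in>{t..<horizon G}. \<forall>y\<in>paths_from G t x. \<forall>z\<in>states G (Suc s).
        \<P>(X in measure_pmf P. X (Suc s) = z \<bar> agree s X y) = trans_prob G s y (\<lambda>i. \<alpha> i s y) z)"

definition law :: "('s, 'a, 'n) game \<Rightarrow> nat \<Rightarrow> (nat \<Rightarrow> 's) \<Rightarrow>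
    ('n \<Rightarrow> nat \<Rightarrow> (nat \<Rightarrow> 's) \<Rightarrow> 'a) \<Rightarrow> (nat \<Rightarrow> 's) pmf" where
  "law G t x \<alpha> = (THE P. is_law G t x \<alpha> P)"


section \<open>Costs, Nash equilibria and the set value\<close>

definition cost :: "('s, 'a, 'n::finite) game \<Rightarrow> nat \<Rightarrow> (nat \<Rightarrow> 's) \<Rightarrow>
    ('n \<Rightarrow> nat \<Rightarrow> (nat \<Rightarrow> 's) \<Rightarrow> 'a) \<Rightarrow> real ^ 'n" where
  "cost G t x \<alpha> = (\<chi> i. measure_pmf.expectation (law G t x \<alpha>)
     (\<lambda>X. term_cost G i X + (\<Sum>s\<in>{t..<horizon G}. run_cost G i s X (\<alpha> i s X))))"

definition nash :: "('s, 'a, 'n::finite) game \<Rightarrow> nat \<Rightarrow> (nat \<Rightarrow> 's) \<Rightarrow>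
    ('n \<Rightarrow> nat \<Rightarrow> (nat \<Rightarrow> 's) \<Rightarrow> 'a) set" where
  "nash G t x = {\<alpha> \<in> controls G.
     \<forall>i. \<forall>\<beta>\<in>player_controls G i. cost G t x \<alpha> $ i \<le> cost G t x (\<alpha>(i := \<beta>)) $ i}"

definition set_value :: "('s, 'a, 'n::finite) game \<Rightarrow> nat \<Rightarrow> (nat \<Rightarrow> 's) \<Rightarrow> (real ^ 'n) set" where
  "set_value G t x = {cost G t x \<alpha> | \<alpha>. \<alpha> \<in> nash G t x}"

definition stopped_cost :: "('s, 'a, 'n::finite) game \<Rightarrow> ((nat \<Rightarrow> 's) \<Rightarrow> nat) \<Rightarrow>
    ((nat \<Rightarrow> 's) \<Rightarrow> real ^ 'n) \<Rightarrow> nat \<Rightarrow> (nat \<Rightarrow> 's) \<Rightarrow>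
    ('n \<Rightarrow> nat \<Rightarrow> (nat \<Rightarrow> 's) \<Rightarrow> 'a) \<Rightarrow> real ^ 'n" where
  "stopped_cost G \<tau> \<psi> t x \<alpha> = (\<chi> i. measure_pmf.expectation (law G t x \<alpha>)
     (\<lambda>X. \<psi> X $ i + (\<Sum>s\<in>{t..<\<tau> X}. run_cost G i s X (\<alpha> i s X))))"

definition stopped_nash :: "('s, 'a, 'n::finite) game \<Rightarrow> ((nat \<Rightarrow> 's) \<Rightarrow> nat) \<Rightarrow>
    ((nat \<Rightarrow> 's) \<Rightarrow> real ^ 'n) \<Rightarrow> nat \<Rightarrow> (nat \<Rightarrow> 's) \<Rightarrow>
    ('n \<Rightarrow> nat \<Rightarrow> (nat \<Rightarrow> 's) \<Rightarrow> 'a) set" where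
  "stopped_nash G \<tau> \<psi> t x = {\<alpha> \<in> controls G.
     \<forall>i. \<forall>\<beta>\<in>player_controls G i.
       stopped_cost G \<tau> \<psi> t x \<alpha> $ i \<le> stopped_cost G \<tau> \<psi> t x (\<alpha>(i := \<beta>)) $ i}"


section \<open>Canonical filtration and stopping times\<close>

text \<open>
  The library indexes filtrations by a whole type, so the canonical filtration is kept constant
  after the horizon, and stopping times are required separately to take values in
  \<^const>\<open>time_set\<close>.
\<close>

definition canonical_filtration :: "('s, 'a, 'n) game \<Rightarrow> nat \<Rightarrow> (nat \<Rightarrow> 's) measure" where
  "canonical_filtration G t =
     sigma (paths G) {{x \<in> paths G. x s \<in> B} | s B. s \<in> time_set G \<and> s \<le> t \<and> B \<subseteq> states G s}"

definition game_stopping_time :: "('s, 'a, 'n) game \<Rightarrow> ((nat \<Rightarrow> 's) \<Rightarrow> nat) \<Rightarrow> bool" where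
  "game_stopping_time G \<tau> \<longleftrightarrow>
     stopping_time (canonical_filtration G) \<tau> \<and> (\<forall>x\<in>paths G. \<tau> x \<in> time_set G)"

definition stopped_sigma ::
    "('s, 'a, 'n) game \<Rightarrow> ((nat \<Rightarrow> 's) \<Rightarrow> nat) \<Rightarrow> (nat \<Rightarrow> 's) measure" where
  "stopped_sigma G \<tau> = filtration.pre_sigma (paths G) (canonical_filtration G) \<tau>"

lemma filtration_canonical: "filtration (paths G) (canonical_filtration G)"
proof
  show "space (canonical_filtration G i) = paths G" for i
    unfolding canonical_filtration_def by (rule space_measure_of) auto
  show "sets (canonical_filtration G i) \<subseteq> sets (canonical_filtration G j)" if "i \<le> j" for i j
  proof -
    let ?B = "\<lambda>t. {{x \<in> paths G. x s \<in> B} | s B. s \<in> time_set G \<and> s \<le> t \<and> B \<subseteq> states G s}"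
    have "?B k \<subseteq> Pow (paths G)" for k by auto
    moreover have "?B i \<subseteq> ?B j" using that by (blast intro: order_trans)
    ultimately show ?thesis
      unfolding canonical_filtration_def by (simp add: sets_measure_of sigma_sets_mono')
  qed
qed


section \<open>Well-definedness of the law\<close>

lemma agree_Suc: "agree (Suc s) x y \<longleftrightarrow> agree s x y \<and> x (Suc s) = y (Suc s)"
  by (auto simp: agree_def le_Suc_eq)

lemma agree_mono: "agree t x y \<Longrightarrow> s \<le> t \<Longrightarrow> agree s x y"
  by (auto simp: agree_def)

lemma finite_paths: "is_game G \<Longrightarrow> finite (paths G)"
  unfolding paths_def is_game_def time_set_def by (intro finite_PiE) auto

lemma paths_eqI: "x \<in> paths G \<Longrightarrow> y \<in> paths G \<Longrightarrow> agree (horizon G) x y \<Longrightarrow> x = y"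
  unfolding paths_def time_set_def agree_def by (rule PiE_ext) auto

lemma controls_vals:
  "\<alpha> \<in> controls G \<Longrightarrow> t \<in> time_set G \<Longrightarrow> x \<in> paths G \<Longrightarrow>
     (\<lambda>i. \<alpha> i t x) \<in> (\<Pi> i\<in>UNIV. ctrl_vals G i)"
  by (auto simp: controls_def player_controls_def Pi_iff)

lemma trans_prob_pos:
  assumes "is_game G" "\<alpha> \<in> controls G" "s < horizon G" "y \<in> paths G" "z \<in> states G (Suc s)"
  shows "0 < trans_prob G s y (\<lambda>i. \<alpha> i s y) z"
  using controls_vals[OF assms(2), of s y] assms unfolding is_game_def time_set_def by auto

lemma trans_prob_sum:
  assumes "is_game G" "\<alpha> \<in> controls G" "s < horizon G" "y \<in> paths G"
  shows "(\<Sum>z\<in>states G (Suc s). trans_prob G s y (\<lambda>i. \<alpha> i s y) z) = 1"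
  using controls_vals[OF assms(2), of s y] assms unfolding is_game_def time_set_def by auto

lemma trans_prob_cong:
  assumes "is_game G" "\<alpha> \<in> controls G" "s < horizon G" "y \<in> paths G" "y' \<in> paths G"
    "agree s y y'" "z \<in> states G (Suc s)"
  shows "trans_prob G s y (\<lambda>i. \<alpha> i s y) z = trans_prob G s y' (\<lambda>i. \<alpha> i s y') z"
proof -
  have "(\<lambda>i. \<alpha> i s y) = (\<lambda>i. \<alpha> i s y')"
    using assms by (auto simp: controls_def player_controls_def Pi_iff adapted_def time_set_def)
  then show ?thesis
    using controls_vals[OF assms(2), of s y'] assms unfolding is_game_def time_set_def by auto
qed

definition path_weight :: "('s, 'a, 'n) game \<Rightarrow> ('n \<Rightarrow> nat \<Rightarrow> (nat \<Rightarrow> 's) \<Rightarrow> 'a) \<Rightarrow>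
    nat \<Rightarrow> nat \<Rightarrow> (nat \<Rightarrow> 's) \<Rightarrow> real" where
  "path_weight G \<alpha> t s y = (\<Prod>r\<in>{t..<s}. trans_prob G r y (\<lambda>i. \<alpha> i r y) (y (Suc r)))"

lemma is_law_weight:
  assumes G: "is_game G" "\<alpha> \<in> controls G" and P: "is_law G t x \<alpha> P"
    and y: "y \<in> paths_from G t x" and s: "t \<le> s" "s \<le> horizon G"
  shows "measure_pmf.prob P {X. agree s X y} = path_weight G \<alpha> t s y"
  using s
proof (induction s rule: dec_induct)
  case base
  have "{X. agree t X y} = {X. agree t X x}"
    using y by (auto simp: paths_from_def agree_def)
  then show ?case using P by (simp add: is_law_def path_weight_def)
next
  case (step s)
  have yz: "y (Suc s) \<in> states G (Suc s)" "y \<in> paths G"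
    using y step.prems by (auto simp: paths_from_def paths_def time_set_def)
  have "trans_prob G s y (\<lambda>i. \<alpha> i s y) (y (Suc s)) =
      \<P>(X in measure_pmf P. X (Suc s) = y (Suc s) \<bar> agree s X y)"
    using P step y yz by (auto simp: is_law_def)
  also have "\<dots> = measure_pmf.prob P {X. agree (Suc s) X y} / measure_pmf.prob P {X. agree s X y}"
    by (simp add: cond_prob_def agree_Suc conj_commute)
  finally have *: "trans_prob G s y (\<lambda>i. \<alpha> i s y) (y (Suc s)) = \<dots>" .
  then have "measure_pmf.prob P {X. agree s X y} \<noteq> 0"
    using trans_prob_pos[OF G _ yz(2,1)] step.prems by auto
  with * step show ?case
    by (simp add: path_weight_def field_simps)
qed

lemma is_law_unique:
  assumes G: "is_game G" "\<alpha> \<in> controls G" and t: "t \<in> time_set G"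
    and P: "is_law G t x \<alpha> P" and Q: "is_law G t x \<alpha> Q"
  shows "P = Q"
proof -
  have *: "pmf P y = (if y \<in> paths_from G t x then path_weight G \<alpha> t (horizon G) y else 0)"
    if P: "is_law G t x \<alpha> P" for P y
  proof (cases "y \<in> paths_from G t x")
    case True
    have "pmf P y = measure_pmf.prob P {X. agree (horizon G) X y}"
      unfolding measure_pmf_single[symmetric]
    proof (rule measure_pmf.finite_measure_eq_AE)
      show "AE X in measure_pmf P. (X \<in> {y}) = (X \<in> {X. agree (horizon G) X y})"
        using P True by (auto simp: AE_measure_pmf_iff is_law_def paths_from_def agree_def
            intro!: paths_eqI)
    qed auto
    then show ?thesis
      using True is_law_weight[OF G P True] t by (simp add: time_set_def)
  next
    case False
    have "AE X in measure_pmf P. agree t X x"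
      using P by (subst measure_pmf.prob_Collect_eq_1[symmetric]) (simp_all add: is_law_def)
    then have "y \<notin> set_pmf P"
      using False P by (auto simp: AE_measure_pmf_iff is_law_def paths_from_def)
    then show ?thesis using False by (simp add: set_pmf_iff)
  qed
  show ?thesis by (rule pmf_eqI) (simp add: *[OF P] *[OF Q])
qed

definition step_pmf :: "('s, 'a, 'n) game \<Rightarrow> ('n \<Rightarrow> nat \<Rightarrow> (nat \<Rightarrow> 's) \<Rightarrow> 'a) \<Rightarrow>
    nat \<Rightarrow> (nat \<Rightarrow> 's) \<Rightarrow> 's pmf" where
  "step_pmf G \<alpha> s y = embed_pmf (\<lambda>z. if z \<in> states G (Suc s)
     then trans_prob G s y (\<lambda>i. \<alpha> i s y) z else 0)"

lemma pmf_step_pmf: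
  assumes "is_game G" "\<alpha> \<in> controls G" "s < horizon G" "y \<in> paths G"
  shows "pmf (step_pmf G \<alpha> s y) z =
    (if z \<in> states G (Suc s) then trans_prob G s y (\<lambda>i. \<alpha> i s y) z else 0)"
  unfolding step_pmf_def
proof (rule pmf_embed_pmf)
  let ?f = "\<lambda>z. if z \<in> states G (Suc s) then trans_prob G s y (\<lambda>i. \<alpha> i s y) z else 0"
  have fin: "finite (states G (Suc s))" using assms by (auto simp: is_game_def time_set_def)
  show nn: "0 \<le> ?f z" for z using trans_prob_pos[OF assms, of z] by (auto simp: less_imp_le)
  have "(\<integral>\<^sup>+ z. ennreal (?f z) \<partial>count_space UNIV) = (\<Sum>z\<in>states G (Suc s). ennreal (?f z))"
    by (rule nn_integral_count_space'[OF fin]) auto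
  also have "\<dots> = ennreal (\<Sum>z\<in>states G (Suc s). ?f z)"
    by (rule sum_ennreal) (rule nn)
  finally show "(\<integral>\<^sup>+ z. ennreal (?f z) \<partial>count_space UNIV) = 1"
    using trans_prob_sum[OF assms] by simp
qed

primrec law_upto :: "('s, 'a, 'n) game \<Rightarrow> nat \<Rightarrow> (nat \<Rightarrow> 's) \<Rightarrow>
    ('n \<Rightarrow> nat \<Rightarrow> (nat \<Rightarrow> 's) \<Rightarrow> 'a) \<Rightarrow> nat \<Rightarrow> (nat \<Rightarrow> 's) pmf" where
  "law_upto G t x \<alpha> 0 = return_pmf x"
| "law_upto G t x \<alpha> (Suc n) = bind_pmf (law_upto G t x \<alpha> n)
     (\<lambda>X. map_pmf (\<lambda>z. X(Suc (t + n) := z)) (step_pmf G \<alpha> (t + n) X))"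

lemma law_upto_support:
  assumes G: "is_game G" "\<alpha> \<in> controls G" "x \<in> paths G" and n: "t + n \<le> horizon G"
  shows "set_pmf (law_upto G t x \<alpha> n) \<subseteq> paths_from G t x"
  using n
proof (induction n)
  case 0
  then show ?case using G by (auto simp: paths_from_def agree_def)
next
  case (Suc n)
  show ?case
  proof
    fix Y assume "Y \<in> set_pmf (law_upto G t x \<alpha> (Suc n))"
    then obtain X z where X: "X \<in> set_pmf (law_upto G t x \<alpha> n)"
      and z: "z \<in> set_pmf (step_pmf G \<alpha> (t + n) X)" and Y: "Y = X(Suc (t + n) := z)" by auto
    have X': "X \<in> paths_from G t x" using X Suc by auto
    have "z \<in> states G (Suc (t + n))"
      using z pmf_step_pmf[OF G(1,2), of "t + n" X z] X' Suc.prems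
      by (auto simp: set_pmf_iff paths_from_def split: if_splits)
    then show "Y \<in> paths_from G t x"
      using X' Suc.prems unfolding Y
      by (auto simp: paths_from_def paths_def time_set_def agree_def PiE_iff extensional_def)
  qed
qed

lemma law_upto_weight:
  assumes G: "is_game G" "\<alpha> \<in> controls G" "x \<in> paths G" and n: "t + n \<le> horizon G"
    and y: "y \<in> paths_from G t x" and s: "t \<le> s" "s \<le> t + n"
  shows "measure_pmf.prob (law_upto G t x \<alpha> n) {X. agree s X y} = path_weight G \<alpha> t s y"
  using n s
proof (induction n arbitrary: s)
  case 0
  then show ?case using y by (auto simp: path_weight_def paths_from_def agree_def)
next
  case (Suc n)
  let ?P = "law_upto G t x \<alpha> n"
  have supp: "X \<in> paths G" if "X \<in> set_pmf ?P" for X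
    using law_upto_support[OF G, of t n] Suc.prems that by (auto simp: paths_from_def)
  have eq: "measure_pmf.prob (law_upto G t x \<alpha> (Suc n)) A =
      measure_pmf.expectation ?P (\<lambda>X. measure_pmf.prob (step_pmf G \<alpha> (t + n) X)
        ((\<lambda>z. X(Suc (t + n) := z)) -` A))" for A
    by (subst integral_eq_nn_integral)
      (auto simp: measure_def[of "measure_pmf (bind_pmf _ _)"] measure_pmf.emeasure_eq_measure
        simp flip: measure_pmf.emeasure_eq_measure)
  have yp: "y \<in> paths G" "y (Suc (t + n)) \<in> states G (Suc (t + n))"
    using y Suc.prems by (auto simp: paths_from_def paths_def time_set_def)
  show ?case
  proof (cases "s \<le> t + n")
    case True
    have "(\<lambda>z. X(Suc (t + n) := z)) -` {X. agree s X y} = (if agree s X y then UNIV else {})" for X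
      using True by (auto simp: agree_def)
    then have "measure_pmf.prob (law_upto G t x \<alpha> (Suc n)) {X. agree s X y} =
        measure_pmf.expectation ?P (\<lambda>X. indicator {X. agree s X y} X)"
      unfolding eq by (intro Bochner_Integration.integral_cong) (auto split: split_indicator)
    then show ?thesis using Suc True by simp
  next
    case False
    then have s: "s = Suc (t + n)" using Suc.prems by simp
    let ?q = "trans_prob G (t + n) y (\<lambda>i. \<alpha> i (t + n) y) (y (Suc (t + n)))"
    have "(\<lambda>z. X(Suc (t + n) := z)) -` {X. agree s X y} =
        (if agree (t + n) X y then {y (Suc (t + n))} else {})" for X
      by (auto simp: s agree_def le_Suc_eq)
    then have "measure_pmf.prob (law_upto G t x \<alpha> (Suc n)) {X. agree s X y} =
        measure_pmf.expectation ?P (\<lambda>X. if agree (t + n) X y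
          then pmf (step_pmf G \<alpha> (t + n) X) (y (Suc (t + n))) else 0)"
      unfolding eq
      by (intro Bochner_Integration.integral_cong) (auto simp: measure_pmf_single)
    also have "\<dots> = measure_pmf.expectation ?P (\<lambda>X. indicator {X. agree (t + n) X y} X * ?q)"
    proof (rule integral_cong_AE)
      show "AE X in measure_pmf ?P. (if agree (t + n) X y
          then pmf (step_pmf G \<alpha> (t + n) X) (y (Suc (t + n))) else 0) =
          indicator {X. agree (t + n) X y} X * ?q"
        using Suc.prems supp yp trans_prob_cong[OF G(1,2), of "t + n" _ y]
        by (auto simp: AE_measure_pmf_iff pmf_step_pmf[OF G(1,2)])
    qed auto
    also have "\<dots> = path_weight G \<alpha> t (t + n) y * ?q"
      using Suc.IH[of "t + n"] Suc.prems by simp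
    finally show ?thesis by (simp add: s path_weight_def)
  qed
qed

lemma is_law_exists:
  assumes G: "is_game G" "\<alpha> \<in> controls G" "x \<in> paths G" and t: "t \<in> time_set G"
  shows "is_law G t x \<alpha> (law_upto G t x \<alpha> (horizon G - t))"
proof -
  let ?n = "horizon G - t"
  let ?P = "law_upto G t x \<alpha> ?n"
  have n: "t + ?n \<le> horizon G" "t + ?n = horizon G" using t by (auto simp: time_set_def)
  note supp = law_upto_support[OF G n(1)]
  note weight = law_upto_weight[OF G n(1), unfolded n(2)]
  have "AE X in measure_pmf ?P. agree t X x"
    using supp by (auto simp: AE_measure_pmf_iff paths_from_def)
  then have 1: "\<P>(X in measure_pmf ?P. agree t X x) = 1"
    by (subst measure_pmf.prob_Collect_eq_1) simp_all
  have 2: "\<P>(X in measure_pmf ?P. X (Suc s) = z \<bar> agree s X y) = trans_prob G s y (\<lambda>i. \<alpha> i s y) z"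
    if s: "s \<in> {t..<horizon G}" and y: "y \<in> paths_from G t x" and z: "z \<in> states G (Suc s)" for s y z
  proof -
    define y' where "y' = y(Suc s := z)"
    have yp: "y \<in> paths G" "y' \<in> paths G" "y' \<in> paths_from G t x"
      using s y z by (auto simp: y'_def paths_from_def paths_def time_set_def agree_def PiE_iff
          extensional_def)
    have ag: "agree r y' y" if "r \<le> s" for r using that by (auto simp: y'_def agree_def)
    have w: "path_weight G \<alpha> t r y' > 0" if "t \<le> r" "r \<le> horizon G" for r
      unfolding path_weight_def using that yp G
      by (intro prod_pos trans_prob_pos[OF G(1,2)]) (auto simp: paths_def time_set_def)
    have "{X. agree s X y} = {X. agree s X y'}" by (auto simp: y'_def agree_def)
    then have "measure_pmf.prob ?P {X. agree s X y} = path_weight G \<alpha> t s y'"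
      using weight[OF yp(3), of s] s by simp
    moreover have "{X. X (Suc s) = z \<and> agree s X y} = {X. agree (Suc s) X y'}"
      by (auto simp: y'_def agree_def le_Suc_eq)
    then have "measure_pmf.prob ?P {X. X (Suc s) = z \<and> agree s X y} = path_weight G \<alpha> t (Suc s) y'"
      using weight[OF yp(3), of "Suc s"] s by simp
    moreover have "path_weight G \<alpha> t (Suc s) y' =
        path_weight G \<alpha> t s y' * trans_prob G s y' (\<lambda>i. \<alpha> i s y') z"
      using s by (simp add: path_weight_def y'_def)
    ultimately show ?thesis
      using w[of s] s z trans_prob_cong[OF G(1,2) _ yp(2,1) ag[OF order_refl] z]
      by (simp add: cond_prob_def)
  qed
  show ?thesis unfolding is_law_def using supp 1 2 by (auto simp: paths_from_def)
qed

lemma law_is_law: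
  assumes "is_game G" "\<alpha> \<in> controls G" "x \<in> paths G" "t \<in> time_set G"
  shows "is_law G t x \<alpha> (law G t x \<alpha>)"
  unfolding law_def
proof (rule theI)
  show "is_law G t x \<alpha> (law_upto G t x \<alpha> (horizon G - t))"
    by (rule is_law_exists[OF assms])
  then show "P = law_upto G t x \<alpha> (horizon G - t)" if "is_law G t x \<alpha> P" for P
    using is_law_unique[OF assms(1,2,4) that] by blast
qed

end

theory Submission
  imports Defs
begin

text \<open>
  Two facts carry the proof. First, the tower property: the cost of a profile equals its stopped cost
  with terminal value the cost from \<open>\<tau>\<close> on, and the law up to \<open>\<tau>\<close> does not see the controls from
  \<open>\<tau>\<close> on. Hence the profile that plays \<open>\<alpha>\<close> before \<open>\<tau>\<close> and \<open>\<gamma> y\<close> after \<open>\<tau>\<close> along \<open>y\<close> has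
  as cost the stopped cost of \<open>\<alpha>\<close> with terminal value \<open>cost (\<tau> y) y (\<gamma> y)\<close>. Second, since transition
  probabilities are strictly positive, an equilibrium at \<open>(t, x)\<close> stays one at \<open>(\<tau> y, y)\<close> for
  every continuation \<open>y\<close>. Deviations before and after \<open>\<tau>\<close> can thus be examined separately.
\<close>

section \<open>Stopping times on the path space\<close>

text \<open>Pathwise counterpart of being measurable at \<open>\<tau>\<close>. The value type is
  arbitrary, so the notion also applies to maps from paths to control profiles, which carry no
  sigma-algebra.\<close>

definition stopped_fun :: "('s, 'a, 'n) game \<Rightarrow> ((nat \<Rightarrow> 's) \<Rightarrow> nat) \<Rightarrow> ((nat \<Rightarrow> 's) \<Rightarrow> 'b) \<Rightarrow> bool" where
  "stopped_fun G \<tau> \<psi> \<longleftrightarrow> (\<forall>y\<in>paths G. \<forall>z\<in>paths G. agree (\<tau> y) y z \<longrightarrow> \<psi> z = \<psi> y)"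

text \<open>Galmarino's characterization of stopping times on a path space.\<close>

definition path_stopping_time :: "('s, 'a, 'n) game \<Rightarrow> ((nat \<Rightarrow> 's) \<Rightarrow> nat) \<Rightarrow> bool" where
  "path_stopping_time G \<tau> \<longleftrightarrow> (\<forall>y\<in>paths G. \<tau> y \<in> time_set G) \<and> stopped_fun G \<tau> \<tau>"

lemma stopped_funD:
  "stopped_fun G \<tau> \<psi> \<Longrightarrow> y \<in> paths G \<Longrightarrow> z \<in> paths G \<Longrightarrow> agree (\<tau> y) y z \<Longrightarrow> \<psi> z = \<psi> y"
  by (auto simp: stopped_fun_def)

lemma agree_refl [simp]: "agree t x x"
  by (simp add: agree_def)

lemma agree_sym: "agree t x y \<Longrightarrow> agree t y x"
  by (simp add: agree_def)

lemma agree_trans: "agree t x y \<Longrightarrow> agree t y z \<Longrightarrow> agree t x z"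
  by (simp add: agree_def)

section \<open>Measurability for the canonical filtration as invariance under
  \<open>agree\<close>\<close>

lemma space_canonical_filtration: "space (canonical_filtration G t) = paths G"
  by (rule filtration.space_F[OF filtration_canonical])

text \<open>Induction over the generated sigma-algebra: the generators only read coordinates up to
  \<open>t\<close>, and complements and countable unions preserve this invariance.\<close>

lemma canonical_filtration_sets_closed:
  assumes "A \<in> sets (canonical_filtration G t)" "y \<in> paths G" "z \<in> paths G" "agree t y z"
  shows "y \<in> A \<longleftrightarrow> z \<in> A"
proof -
  let ?B = "{{x \<in> paths G. x s \<in> B} | s B. s \<in> time_set G \<and> s \<le> t \<and> B \<subseteq> states G s}"
  have "sets (canonical_filtration G t) = sigma_sets (paths G) ?B"
    unfolding canonical_filtration_def by (rule sets_measure_of) auto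
  with assms(1) have "A \<in> sigma_sets (paths G) ?B" by simp
  then show ?thesis
    using assms(2-4) by (induction A rule: sigma_sets.induct) (auto simp: agree_def)
qed

text \<open>Paths are extensional, so beyond the horizon they all take the same default value. This
  covers filtration indices past the horizon.\<close>

lemma paths_agree_above:
  assumes "y \<in> paths G" "x \<in> paths G" "horizon G < s"
  shows "y s = x s"
  using assms by (auto simp: paths_def time_set_def PiE_iff extensional_def)

lemma canonical_filtration_atom:
  assumes x: "x \<in> paths G"
  shows "{y \<in> paths G. agree t y x} \<in> sets (canonical_filtration G t)"
proof -
  let ?F = "canonical_filtration G t"
  have cyl: "{y \<in> paths G. y s = x s} \<in> sets ?F" if s: "s \<le> t" for s
  proof (cases "s \<in> time_set G")
    case True
    have "x s \<in> states G s" using x True by (auto simp: paths_def)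
    with True s have "{y \<in> paths G. y s \<in> {x s}} \<in> sets ?F"
      unfolding canonical_filtration_def by (intro in_measure_of) blast+
    then show ?thesis by simp
  next
    case False
    then have "{y \<in> paths G. y s = x s} = paths G"
      using paths_agree_above[OF _ x, of _ s] by (auto simp: time_set_def)
    then show ?thesis
      using sets.top[of ?F] by (simp add: space_canonical_filtration)
  qed
  have "{y \<in> paths G. agree t y x} = (\<Inter>s\<in>{..t}. {y \<in> paths G. y s = x s})"
    by (auto simp: agree_def)
  also have "\<dots> \<in> sets ?F"
    using cyl by (intro sets.finite_INT) auto
  finally show ?thesis .
qed

text \<open>There are only finitely many paths, so an invariant set is a finite union of
  atoms.\<close>

lemma canonical_filtration_setsI:
  assumes G: "is_game G" and A: "A \<subseteq> paths G"
    and closed: "\<And>y z. y \<in> A \<Longrightarrow> z \<in> paths G \<Longrightarrow> agree t z y \<Longrightarrow> z \<in> A"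
  shows "A \<in> sets (canonical_filtration G t)"
proof -
  have "A = (\<Union>x\<in>A. {y \<in> paths G. agree t y x})"
    using A closed by auto
  also have "\<dots> \<in> sets (canonical_filtration G t)"
    using A finite_subset[OF A finite_paths[OF G]] canonical_filtration_atom
    by (intro sets.finite_UN) auto
  finally show ?thesis .
qed

lemma game_stopping_time_path:
  assumes "game_stopping_time G \<tau>"
  shows "path_stopping_time G \<tau>"
proof -
  have "\<tau> z = \<tau> y" if y: "y \<in> paths G" and z: "z \<in> paths G" and a: "agree (\<tau> y) y z" for y z
  proof -
    have "{w \<in> paths G. \<tau> w \<le> s} \<in> sets (canonical_filtration G s)" for s
      using assms unfolding game_stopping_time_def stopping_time_def pred_def
      by (simp add: space_canonical_filtration)
    note * = canonical_filtration_sets_closed[OF this y z]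
    \<comment> \<open>The event that \<open>\<tau>\<close> is at most \<open>\<tau> y\<close>
      contains \<open>y\<close> and is decided by the path up to \<open>\<tau> y\<close>, so it
      contains \<open>z\<close>. This bound then gives agreement up to \<open>\<tau> z\<close>,
      which is what the reverse inequality needs.\<close>
    have "\<tau> z \<le> \<tau> y" using *[of "\<tau> y"] a y z by auto
    moreover have "\<tau> y \<le> \<tau> z" using *[of "\<tau> z"] agree_mono[OF a \<open>\<tau> z \<le> \<tau> y\<close>] y z by auto
    ultimately show ?thesis by simp
  qed
  then show ?thesis
    using assms unfolding path_stopping_time_def stopped_fun_def game_stopping_time_def by blast
qed

text \<open>Translates the measurability in the theorem into a condition on pairs of paths; all
  later arguments use only the latter.\<close>

lemma stopped_measurable_iff:
  fixes \<psi> :: "(nat \<Rightarrow> 's) \<Rightarrow> 'b::t1_space"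
  assumes G: "is_game G" and \<tau>: "game_stopping_time G \<tau>"
  shows "\<psi> \<in> borel_measurable (stopped_sigma G \<tau>) \<longleftrightarrow> stopped_fun G \<tau> \<psi>"
proof
  interpret filtration "paths G" "canonical_filtration G" by (rule filtration_canonical)
  have st: "stopping_time (canonical_filtration G) \<tau>"
    using \<tau> by (simp add: game_stopping_time_def)
  note sets = sets_pre_sigma[OF st, folded stopped_sigma_def]
  note space = space_pre_sigma[of \<tau>, folded stopped_sigma_def]
  {
    assume \<psi>: "\<psi> \<in> borel_measurable (stopped_sigma G \<tau>)"
    show "stopped_fun G \<tau> \<psi>"
      unfolding stopped_fun_def
    proof (intro ballI impI)
      fix y z assume yz: "y \<in> paths G" "z \<in> paths G" "agree (\<tau> y) y z"
      \<comment> \<open>In a T1 space the singleton is closed, hence Borel.\<close>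
      have "\<psi> -` {\<psi> y} \<inter> space (stopped_sigma G \<tau>) \<in> sets (stopped_sigma G \<tau>)"
        by (rule measurable_sets[OF \<psi>]) auto
      then have "{w \<in> \<psi> -` {\<psi> y} \<inter> paths G. \<tau> w \<le> \<tau> y} \<in> sets (canonical_filtration G (\<tau> y))"
        by (simp add: sets space)
      from canonical_filtration_sets_closed[OF this yz] show "\<psi> z = \<psi> y"
        using yz by auto
    qed
  next
    assume \<psi>: "stopped_fun G \<tau> \<psi>"
    show "\<psi> \<in> borel_measurable (stopped_sigma G \<tau>)"
    proof (rule measurableI)
      fix A assume "A \<in> sets (borel :: 'b measure)"
      have "{w \<in> \<psi> -` A \<inter> paths G. \<tau> w \<le> s} \<in> sets (canonical_filtration G s)" for s
      proof (rule canonical_filtration_setsI[OF G])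
        fix y z
        assume y: "y \<in> {w \<in> \<psi> -` A \<inter> paths G. \<tau> w \<le> s}" and z: "z \<in> paths G" "agree s z y"
        then have "agree (\<tau> y) y z" using agree_mono agree_sym by blast
        then have "\<psi> z = \<psi> y" "\<tau> z = \<tau> y"
          using y z stopped_funD[OF \<psi>, of y z] stopped_funD[of G \<tau> \<tau> y z]
            game_stopping_time_path[OF \<tau>]
          by (auto simp: path_stopping_time_def)
        then show "z \<in> {w \<in> \<psi> -` A \<inter> paths G. \<tau> w \<le> s}" using y z by auto
      qed auto
      then show "\<psi> -` A \<inter> space (stopped_sigma G \<tau>) \<in> sets (stopped_sigma G \<tau>)"
        by (simp add: sets space)
    qed auto
  }
qed

text \<open>If \<open>\<tau>\<close> had occurred along \<open>y\<close> before \<open>t\<close>, it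
  would have occurred along \<open>x\<close> at the same time, as the two paths coincide until
  then.\<close>

lemma stopping_time_lower_bound:
  assumes "path_stopping_time G \<tau>" "x \<in> paths G" "t \<le> \<tau> x" "y \<in> paths_from G t x"
  shows "t \<le> \<tau> y"
proof (rule ccontr)
  assume "\<not> t \<le> \<tau> y"
  then have "agree (\<tau> y) y x"
    using assms(4) agree_mono[of t y x "\<tau> y"] by (simp add: paths_from_def)
  then have "\<tau> x = \<tau> y"
    using assms stopped_funD[of G \<tau> \<tau> y x]
    by (simp add: path_stopping_time_def paths_from_def)
  with \<open>\<not> t \<le> \<tau> y\<close> assms(3) show False by simp
qed

section \<open>Expectations as finite sums over paths\<close>

text \<open>The expectation under the controlled law with the point masses written out as products
  of transition probabilities, so that conditioning becomes a regrouping of finite sums.\<close>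

definition mean :: "('s, 'a, 'n) game \<Rightarrow> nat \<Rightarrow> (nat \<Rightarrow> 's) \<Rightarrow>
    ('n \<Rightarrow> nat \<Rightarrow> (nat \<Rightarrow> 's) \<Rightarrow> 'a) \<Rightarrow> ((nat \<Rightarrow> 's) \<Rightarrow> real) \<Rightarrow> real" where
  "mean G t x \<alpha> h = (\<Sum>y\<in>paths_from G t x. path_weight G \<alpha> t (horizon G) y * h y)"

lemma finite_paths_from: "is_game G \<Longrightarrow> finite (paths_from G t x)"
  by (simp add: paths_from_def finite_paths)

lemma paths_fromD: "y \<in> paths_from G t x \<Longrightarrow> y \<in> paths G"
  by (simp add: paths_from_def)

lemma paths_from_trans:
  "z \<in> paths_from G s y \<Longrightarrow> y \<in> paths_from G t x \<Longrightarrow> t \<le> s \<Longrightarrow> z \<in> paths_from G t x"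
  using agree_mono[of s z y t] agree_trans[of t z y x] by (simp add: paths_from_def)

lemma paths_from_cong: "agree t x y \<Longrightarrow> paths_from G t x = paths_from G t y"
  by (auto simp: paths_from_def agree_def)

text \<open>The law lives on \<open>paths_from G t x\<close>, and the mass of a path is the
  probability of agreeing with it up to the horizon, which \<open>is_law_weight\<close>
  computes.\<close>

lemma expectation_law:
  assumes G: "is_game G" "\<alpha> \<in> controls G" "x \<in> paths G" "t \<in> time_set G"
  shows "measure_pmf.expectation (law G t x \<alpha>) h = mean G t x \<alpha> h"
proof -
  let ?P = "law G t x \<alpha>"
  note P = law_is_law[OF G]
  have "AE X in measure_pmf ?P. agree t X x"
    using P by (subst measure_pmf.prob_Collect_eq_1[symmetric]) (simp_all add: is_law_def)
  then have supp: "set_pmf ?P \<subseteq> paths_from G t x"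
    using P by (auto simp: AE_measure_pmf_iff is_law_def paths_from_def)
  have "pmf ?P y = path_weight G \<alpha> t (horizon G) y" if y: "y \<in> paths_from G t x" for y
  proof -
    have "pmf ?P y = measure_pmf.prob ?P {X. agree (horizon G) X y}"
      unfolding measure_pmf_single[symmetric]
    proof (rule measure_pmf.finite_measure_eq_AE)
      show "AE X in measure_pmf ?P. (X \<in> {y}) = (X \<in> {X. agree (horizon G) X y})"
        using supp y by (auto simp: AE_measure_pmf_iff paths_from_def intro!: paths_eqI)
    qed auto
    then show ?thesis
      using is_law_weight[OF G(1,2) P y] G(4) by (simp add: time_set_def)
  qed
  then show ?thesis
    using supp by (subst integral_measure_pmf_real[OF finite_paths_from[OF G(1)]])
      (auto simp: mean_def mult.commute intro!: sum.cong)
qed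

text \<open>The weights sum to 1 because they are the point masses of a probability law; no direct
  summation is carried out.\<close>

lemma mean_const:
  assumes "is_game G" "\<alpha> \<in> controls G" "x \<in> paths G" "t \<in> time_set G"
  shows "mean G t x \<alpha> (\<lambda>_. c) = c"
  unfolding expectation_law[OF assms, symmetric] by simp

lemma mean_cong:
  "(\<And>y. y \<in> paths_from G t x \<Longrightarrow> h y = h' y) \<Longrightarrow> mean G t x \<alpha> h = mean G t x \<alpha> h'"
  by (simp add: mean_def)

lemma mean_add: "mean G t x \<alpha> (\<lambda>y. h y + k y) = mean G t x \<alpha> h + mean G t x \<alpha> k"
  by (simp add: mean_def distrib_left sum.distrib)

lemma path_weight_pos:
  assumes "is_game G" "\<alpha> \<in> controls G" "y \<in> paths G" "s \<le> horizon G"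
  shows "path_weight G \<alpha> t s y > 0"
  unfolding path_weight_def
  using assms by (intro prod_pos trans_prob_pos) (auto simp: paths_def time_set_def)

lemma mean_mono:
  assumes "is_game G" "\<alpha> \<in> controls G"
    and "\<And>y. y \<in> paths_from G t x \<Longrightarrow> h y \<le> k y"
  shows "mean G t x \<alpha> h \<le> mean G t x \<alpha> k"
  unfolding mean_def using assms path_weight_pos[OF assms(1,2)]
  by (intro sum_mono mult_left_mono) (auto simp: paths_from_def less_imp_le)

text \<open>Strictly positive transition probabilities leave no continuation with zero weight, so a
  strict inequality on a single path is seen by the mean.\<close>

lemma mean_strict_mono:
  assumes "is_game G" "\<alpha> \<in> controls G"
    and "\<And>y. y \<in> paths_from G t x \<Longrightarrow> h y \<le> k y"
    and "z \<in> paths_from G t x" "h z < k z"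
  shows "mean G t x \<alpha> h < mean G t x \<alpha> k"
  unfolding mean_def
proof (rule sum_strict_mono_ex1[OF finite_paths_from[OF assms(1)]])
  have pos: "path_weight G \<alpha> t (horizon G) y > 0" if "y \<in> paths_from G t x" for y
    using path_weight_pos[OF assms(1,2) paths_fromD[OF that]] by simp
  show "\<forall>y\<in>paths_from G t x. path_weight G \<alpha> t (horizon G) y * h y
      \<le> path_weight G \<alpha> t (horizon G) y * k y"
    using pos assms(3) by (auto intro!: mult_left_mono less_imp_le)
  show "\<exists>y\<in>paths_from G t x. path_weight G \<alpha> t (horizon G) y * h y
      < path_weight G \<alpha> t (horizon G) y * k y"
    using pos assms(4,5) by (auto intro!: bexI[of _ z])
qed

section \<open>Factorization of path weights and conditioning at a stopping time\<close>

lemma path_weight_split: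
  "t \<le> s \<Longrightarrow> s \<le> u \<Longrightarrow> path_weight G \<alpha> t u y = path_weight G \<alpha> t s y * path_weight G \<alpha> s u y"
  by (simp add: path_weight_def prod.atLeastLessThan_concat)

lemma controlsD:
  assumes "\<alpha> \<in> controls G" "s \<in> time_set G" "y \<in> paths G" "z \<in> paths G" "agree s y z"
  shows "\<alpha> i s y = \<alpha> i s z"
proof -
  have "adapted G (\<alpha> i)"
    using assms(1) by (auto simp: controls_def player_controls_def)
  then show ?thesis
    using assms(2-) unfolding adapted_def by blast
qed

text \<open>The last factor, at time \<open>s - 1\<close>, has target state \<open>y s\<close>, so
  agreement up to and including \<open>s\<close> is exactly what is read.\<close>

lemma path_weight_agree:
  assumes G: "is_game G" "\<alpha> \<in> controls G" and yz: "y \<in> paths G" "z \<in> paths G" "agree s y z"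
    and s: "s \<le> horizon G"
  shows "path_weight G \<alpha> t s y = path_weight G \<alpha> t s z"
  unfolding path_weight_def
proof (rule prod.cong[OF refl])
  fix r assume r: "r \<in> {t..<s}"
  have "y (Suc r) = z (Suc r)" using yz(3) r by (auto simp: agree_def)
  moreover have "z (Suc r) \<in> states G (Suc r)"
    using yz(2) r s by (auto simp: paths_def time_set_def PiE_iff)
  ultimately show "trans_prob G r y (\<lambda>i. \<alpha> i r y) (y (Suc r)) =
      trans_prob G r z (\<lambda>i. \<alpha> i r z) (z (Suc r))"
    using trans_prob_cong[OF G _ yz(1,2), of r] r s agree_mono[OF yz(3), of r] by auto
qed

lemma path_weight_cong:
  assumes "\<And>i r. t \<le> r \<Longrightarrow> r < s \<Longrightarrow> \<alpha> i r y = \<alpha>' i r y"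
  shows "path_weight G \<alpha> t s y = path_weight G \<alpha>' t s y"
  unfolding path_weight_def using assms by (auto intro!: prod.cong)

text \<open>
  For \<open>\<alpha> = \<alpha>'\<close> this is the tower property. Applied to \<open>h\<close> depending only on the path up to \<open>\<tau>\<close>,
  it says that the mean of \<open>h\<close> does not see the controls from \<open>\<tau>\<close> on. Both sides are double sums
  over pairs of paths that agree up to \<open>\<tau>\<close>, a symmetric relation, so the sums can be exchanged.
\<close>
lemma mean_tower:
  assumes G: "is_game G" "\<alpha> \<in> controls G" "\<alpha>' \<in> controls G"
    and \<tau>: "path_stopping_time G \<tau>" "x \<in> paths G" "t \<le> \<tau> x"
    and eq: "\<And>i s y. y \<in> paths_from G t x \<Longrightarrow> t \<le> s \<Longrightarrow> s < \<tau> y \<Longrightarrow> \<alpha> i s y = \<alpha>' i s y"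
  shows "mean G t x \<alpha> (\<lambda>y. mean G (\<tau> y) y \<alpha>' h) = mean G t x \<alpha>' h"
proof -
  let ?T = "horizon G"
  let ?S = "paths_from G t x"
  have sub: "paths_from G (\<tau> y) y = {z \<in> ?S. agree (\<tau> y) z y}" if "y \<in> ?S" for y
    using paths_from_trans[OF _ that stopping_time_lower_bound[OF \<tau> that]]
    by (auto simp: paths_from_def)
  have bd: "t \<le> \<tau> y" "\<tau> y \<le> ?T" "y \<in> paths G" if "y \<in> ?S" for y
    using \<tau> that stopping_time_lower_bound[OF \<tau> that]
    by (auto simp: path_stopping_time_def paths_from_def time_set_def)
  have fin: "finite ?S" by (rule finite_paths_from[OF G(1)])
  have same: "\<tau> z = \<tau> y" if "y \<in> ?S" "z \<in> ?S" "agree (\<tau> y) z y" for y z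
    using that \<tau>(1) bd agree_sym[OF that(3)] stopped_funD[of G \<tau> \<tau> y z]
    by (simp add: path_stopping_time_def)
  \<comment> \<open>Up to the common value of \<open>\<tau>\<close>, the weight of \<open>y\<close>
    under \<alpha> equals that of \<open>z\<close> under \<alpha>'. Moving this factor from
    \<open>y\<close> to \<open>z\<close> gives the identity.\<close>
  have swap: "path_weight G \<alpha> t ?T y * path_weight G \<alpha>' (\<tau> y) ?T z =
      path_weight G \<alpha>' t ?T z * path_weight G \<alpha> (\<tau> z) ?T y"
    if yz: "y \<in> ?S" "z \<in> ?S" "agree (\<tau> y) z y" for y z
  proof -
    have "path_weight G \<alpha> t (\<tau> y) y = path_weight G \<alpha>' t (\<tau> y) y"
      using eq[OF yz(1)] by (intro path_weight_cong) auto
    also have "\<dots> = path_weight G \<alpha>' t (\<tau> y) z"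
      using yz bd agree_sym by (intro path_weight_agree[OF G(1,3)]) auto
    finally show ?thesis
      using path_weight_split[of t "\<tau> y" ?T G \<alpha> y] path_weight_split[of t "\<tau> y" ?T G \<alpha>' z]
        bd[OF yz(1)] same[OF yz] by simp
  qed
  have "mean G t x \<alpha> (\<lambda>y. mean G (\<tau> y) y \<alpha>' h) =
      (\<Sum>y\<in>?S. \<Sum>z\<in>{z \<in> ?S. agree (\<tau> y) z y}.
        path_weight G \<alpha> t ?T y * (path_weight G \<alpha>' (\<tau> y) ?T z * h z))"
    unfolding mean_def by (intro sum.cong) (auto simp: sub sum_distrib_left)
  also have "\<dots> = (\<Sum>y\<in>?S. \<Sum>z\<in>{z \<in> ?S. agree (\<tau> y) z y}.
        path_weight G \<alpha>' t ?T z * path_weight G \<alpha> (\<tau> z) ?T y * h z)"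
    using swap by (intro sum.cong) (auto simp: mult.assoc[symmetric])
  also have "\<dots> = (\<Sum>z\<in>?S. \<Sum>y\<in>{y \<in> ?S. agree (\<tau> y) z y}.
        path_weight G \<alpha>' t ?T z * path_weight G \<alpha> (\<tau> z) ?T y * h z)"
    by (rule sum.swap_restrict[OF fin fin])
  also have "\<dots> = (\<Sum>z\<in>?S. \<Sum>y\<in>paths_from G (\<tau> z) z.
        path_weight G \<alpha>' t ?T z * path_weight G \<alpha> (\<tau> z) ?T y * h z)"
  proof (intro sum.cong refl)
    fix z assume z: "z \<in> ?S"
    have "agree (\<tau> y) z y \<longleftrightarrow> agree (\<tau> z) y z" if "y \<in> ?S" for y
      using same[OF that z] same[OF z that] agree_sym by metis
    then show "{y \<in> ?S. agree (\<tau> y) z y} = paths_from G (\<tau> z) z" using sub[OF z] by auto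
  qed
  \<comment> \<open>After the exchange \<open>y\<close> occurs only in its weight from
    \<open>\<tau> z\<close> on, so the inner sum is a total mass, that is 1.\<close>
  also have "\<dots> = (\<Sum>z\<in>?S. path_weight G \<alpha>' t ?T z * h z * mean G (\<tau> z) z \<alpha> (\<lambda>_. 1))"
    by (simp add: mean_def sum_distrib_left mult_ac)
  also have "\<dots> = mean G t x \<alpha>' h"
    unfolding mean_def[of G t x] using mean_const[OF G(1,2)] bd
    by (intro sum.cong) (auto simp: time_set_def)
  finally show ?thesis .
qed

lemma mean_stopped_cong:
  assumes G: "is_game G" "\<alpha> \<in> controls G" "\<alpha>' \<in> controls G"
    and \<tau>: "path_stopping_time G \<tau>" "x \<in> paths G" "t \<le> \<tau> x"
    and eq: "\<And>i s y. y \<in> paths_from G t x \<Longrightarrow> t \<le> s \<Longrightarrow> s < \<tau> y \<Longrightarrow> \<alpha> i s y = \<alpha>' i s y"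
    and h: "stopped_fun G \<tau> h"
  shows "mean G t x \<alpha> h = mean G t x \<alpha>' h"
proof -
  \<comment> \<open>All continuations of \<open>y\<close> after \<open>\<tau> y\<close> share the
    value \<open>h y\<close>, so averaging over them changes nothing. Inserting this average lets
    \<open>mean_tower\<close> exchange the profiles.\<close>
  have "mean G (\<tau> y) y \<alpha>' h = h y" if y: "y \<in> paths_from G t x" for y
  proof -
    have "mean G (\<tau> y) y \<alpha>' h = mean G (\<tau> y) y \<alpha>' (\<lambda>_. h y)"
      using h paths_fromD[OF y]
      by (intro mean_cong stopped_funD[OF h]) (auto simp: paths_from_def agree_sym)
    also have "\<dots> = h y"
      using \<tau> y by (intro mean_const[OF G(1,3)]) (auto simp: paths_from_def path_stopping_time_def)
    finally show ?thesis .
  qed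
  then have "mean G t x \<alpha> h = mean G t x \<alpha> (\<lambda>y. mean G (\<tau> y) y \<alpha>' h)"
    by (intro mean_cong) simp
  also have "\<dots> = mean G t x \<alpha>' h"
    by (rule mean_tower[OF G \<tau>]) (rule eq)
  finally show ?thesis .
qed

lemma mean_agree: "agree t x y \<Longrightarrow> mean G t x \<alpha> = mean G t y \<alpha>"
  by (simp add: mean_def fun_eq_iff paths_from_cong)

lemma mean_controls_cong:
  assumes "\<And>y i s. y \<in> paths_from G t x \<Longrightarrow> t \<le> s \<Longrightarrow> s < horizon G \<Longrightarrow> \<alpha> i s y = \<alpha>' i s y"
    and "\<And>y. y \<in> paths_from G t x \<Longrightarrow> h y = h' y"
  shows "mean G t x \<alpha> h = mean G t x \<alpha>' h'"
  unfolding mean_def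
proof (rule sum.cong[OF refl])
  fix y assume y: "y \<in> paths_from G t x"
  have "path_weight G \<alpha> t (horizon G) y = path_weight G \<alpha>' t (horizon G) y"
    using assms(1)[OF y] by (rule path_weight_cong)
  with assms(2)[OF y] show "path_weight G \<alpha> t (horizon G) y * h y =
      path_weight G \<alpha>' t (horizon G) y * h' y" by simp
qed

section \<open>Dynamic programming for a fixed control profile\<close>

lemma cost_mean:
  assumes "is_game G" "\<alpha> \<in> controls G" "x \<in> paths G" "t \<in> time_set G"
  shows "cost G t x \<alpha> $ i =
    mean G t x \<alpha> (\<lambda>X. term_cost G i X + (\<Sum>s\<in>{t..<horizon G}. run_cost G i s X (\<alpha> i s X)))"
  by (simp add: cost_def expectation_law[OF assms])

lemma stopped_cost_mean:
  assumes "is_game G" "\<alpha> \<in> controls G" "x \<in> paths G" "t \<in> time_set G"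
  shows "stopped_cost G \<tau> \<psi> t x \<alpha> $ i =
    mean G t x \<alpha> (\<lambda>X. \<psi> X $ i + (\<Sum>s\<in>{t..<\<tau> X}. run_cost G i s X (\<alpha> i s X)))"
  by (simp add: stopped_cost_def expectation_law[OF assms])

lemma cost_agree:
  assumes "is_game G" "\<alpha> \<in> controls G" "x \<in> paths G" "y \<in> paths G" "t \<in> time_set G" "agree t x y"
  shows "cost G t x \<alpha> = cost G t y \<alpha>"
  unfolding vec_eq_iff cost_mean[OF assms(1,2,3,5)] cost_mean[OF assms(1,2,4,5)]
    mean_agree[OF assms(6)] by simp

lemma cost_controls_cong:
  assumes G: "is_game G" "\<alpha> \<in> controls G" "\<alpha>' \<in> controls G" "x \<in> paths G" "t \<in> time_set G"
    and eq: "\<And>y i s. y \<in> paths_from G t x \<Longrightarrow> t \<le> s \<Longrightarrow> s < horizon G \<Longrightarrow> \<alpha> i s y = \<alpha>' i s y"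
  shows "cost G t x \<alpha> = cost G t x \<alpha>'"
  unfolding vec_eq_iff cost_mean[OF G(1,2,4,5)] cost_mean[OF G(1,3,4,5)]
  using eq by (intro allI mean_controls_cong) (auto intro!: sum.cong)

lemma controls_fun_upd:
  "\<alpha> \<in> controls G \<Longrightarrow> \<beta> \<in> player_controls G i \<Longrightarrow> \<alpha>(i := \<beta>) \<in> controls G"
  by (auto simp: controls_def)

lemma nash_agree:
  assumes "is_game G" "x \<in> paths G" "y \<in> paths G" "t \<in> time_set G" "agree t x y"
  shows "nash G t x = nash G t y"
proof -
  note eq = cost_agree[OF assms(1) _ assms(2-5)]
  show ?thesis using eq eq[OF controls_fun_upd] by (auto simp: nash_def)
qed

lemma run_cost_agree:
  assumes "is_game G" "\<alpha> \<in> controls G" "y \<in> paths G" "z \<in> paths G" "s \<in> time_set G" "agree s y z"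
  shows "run_cost G i s y (\<alpha> i s y) = run_cost G i s z (\<alpha> i s z)"
proof -
  \<comment> \<open>Running costs are adapted for each fixed admissible action only, so the action
    is frozen first; adaptedness of \<alpha> then shows that both paths use it.\<close>
  define a where "a = \<alpha> i s z"
  have "a \<in> ctrl_vals G i"
    using controls_vals[OF assms(2,5,4)] by (auto simp: a_def)
  then have "adapted G (\<lambda>s y. run_cost G i s y a)"
    using assms(1) by (simp add: is_game_def)
  then have "run_cost G i s y a = run_cost G i s z a"
    using assms(3-6) unfolding adapted_def by blast
  then show ?thesis
    using controlsD[OF assms(2,5,3,4,6)] by (simp add: a_def)
qed

lemma stopped_fun_run_cost:
  assumes G: "is_game G" "\<alpha> \<in> controls G" and \<tau>: "path_stopping_time G \<tau>"
  shows "stopped_fun G \<tau> (\<lambda>y. \<Sum>s\<in>{t..<\<tau> y}. run_cost G i s y (\<alpha> i s y))"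
  unfolding stopped_fun_def
proof (intro ballI impI)
  fix y z assume yz: "y \<in> paths G" "z \<in> paths G" "agree (\<tau> y) y z"
  have \<tau>yz: "\<tau> z = \<tau> y" "\<tau> y \<le> horizon G"
    using \<tau> yz stopped_funD[of G \<tau> \<tau> y z] by (auto simp: path_stopping_time_def time_set_def)
  have "run_cost G i s y (\<alpha> i s y) = run_cost G i s z (\<alpha> i s z)" if "s < \<tau> y" for s
    using that \<tau>yz agree_mono[OF yz(3), of s]
    by (intro run_cost_agree[OF G yz(1,2)]) (auto simp: time_set_def)
  then show "(\<Sum>s\<in>{t..<\<tau> z}. run_cost G i s z (\<alpha> i s z)) = (\<Sum>s\<in>{t..<\<tau> y}. run_cost G i s y (\<alpha> i s y))"
    unfolding \<tau>yz(1) by (intro sum.cong) auto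
qed

lemma stopped_fun_cost:
  assumes G: "is_game G" and \<tau>: "path_stopping_time G \<tau>"
    and \<gamma>: "stopped_fun G \<tau> \<gamma>" "\<And>y. y \<in> paths G \<Longrightarrow> \<gamma> y \<in> controls G"
  shows "stopped_fun G \<tau> (\<lambda>y. cost G (\<tau> y) y (\<gamma> y))"
  unfolding stopped_fun_def
proof (intro ballI impI)
  fix y z assume yz: "y \<in> paths G" "z \<in> paths G" "agree (\<tau> y) y z"
  have "\<tau> z = \<tau> y" "\<tau> y \<in> time_set G"
    using \<tau> yz stopped_funD[of G \<tau> \<tau> y z] by (auto simp: path_stopping_time_def)
  then show "cost G (\<tau> z) z (\<gamma> z) = cost G (\<tau> y) y (\<gamma> y)"
    using cost_agree[OF G \<gamma>(2) yz(1,2)] stopped_funD[OF \<gamma>(1) yz] yz by simp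
qed

text \<open>Tower property at \<open>\<tau>\<close>: given the path up to \<open>\<tau> y\<close>,
  the running costs before \<open>\<tau> y\<close> are constants and leave the inner mean, and what
  remains there is the cost from \<open>\<tau> y\<close> on.\<close>

lemma cost_dynamic_programming:
  assumes G: "is_game G" "\<alpha> \<in> controls G" "x \<in> paths G" "t \<in> time_set G"
    and \<tau>: "path_stopping_time G \<tau>" "t \<le> \<tau> x"
  shows "cost G t x \<alpha> = stopped_cost G \<tau> (\<lambda>y. cost G (\<tau> y) y \<alpha>) t x \<alpha>"
proof -
  have "cost G t x \<alpha> $ i = stopped_cost G \<tau> (\<lambda>y. cost G (\<tau> y) y \<alpha>) t x \<alpha> $ i" for i
  proof -
    let ?f = "\<lambda>s y. run_cost G i s y (\<alpha> i s y)"
    let ?h = "\<lambda>y. term_cost G i y + (\<Sum>s\<in>{t..<horizon G}. ?f s y)"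
    have "mean G (\<tau> y) y \<alpha> ?h = cost G (\<tau> y) y \<alpha> $ i + (\<Sum>s\<in>{t..<\<tau> y}. ?f s y)"
      if y: "y \<in> paths_from G t x" for y
    proof -
      have bd: "t \<le> \<tau> y" "\<tau> y \<le> horizon G" "y \<in> paths G" "\<tau> y \<in> time_set G"
        using \<tau>(1) y stopping_time_lower_bound[OF \<tau>(1) G(3) \<tau>(2) y]
        by (auto simp: path_stopping_time_def paths_from_def time_set_def)
      let ?k = "\<lambda>z. term_cost G i z + (\<Sum>s\<in>{\<tau> y..<horizon G}. ?f s z)"
      have "mean G (\<tau> y) y \<alpha> ?h = mean G (\<tau> y) y \<alpha> (\<lambda>z. ?k z + (\<Sum>s\<in>{t..<\<tau> y}. ?f s y))"
      proof (rule mean_cong)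
        fix z assume z: "z \<in> paths_from G (\<tau> y) y"
        have "?f s z = ?f s y" if "s < \<tau> y" for s
          using that z bd agree_mono[of "\<tau> y" z y s]
          by (intro run_cost_agree[OF G(1,2)]) (auto simp: paths_from_def time_set_def)
        then have "(\<Sum>s\<in>{t..<\<tau> y}. ?f s z) = (\<Sum>s\<in>{t..<\<tau> y}. ?f s y)"
          by (intro sum.cong) auto
        then show "?h z = ?k z + (\<Sum>s\<in>{t..<\<tau> y}. ?f s y)"
          using sum.atLeastLessThan_concat[OF bd(1,2), of "\<lambda>s. ?f s z"] by simp
      qed
      also have "\<dots> = mean G (\<tau> y) y \<alpha> ?k + (\<Sum>s\<in>{t..<\<tau> y}. ?f s y)"
        by (simp only: mean_add mean_const[OF G(1,2) bd(3,4)])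
      finally show ?thesis
        by (simp only: cost_mean[OF G(1,2) bd(3,4)])
    qed
    note inner = this
    have "cost G t x \<alpha> $ i = mean G t x \<alpha> (\<lambda>y. mean G (\<tau> y) y \<alpha> ?h)"
      unfolding cost_mean[OF G] by (rule mean_tower[OF G(1,2,2) \<tau>(1) G(3) \<tau>(2), symmetric]) simp
    also have "\<dots> = stopped_cost G \<tau> (\<lambda>y. cost G (\<tau> y) y \<alpha>) t x \<alpha> $ i"
      unfolding stopped_cost_mean[OF G] by (rule mean_cong[OF inner])
    finally show ?thesis .
  qed
  then show ?thesis by (simp add: vec_eq_iff)
qed

lemma stopped_cost_controls_cong:
  assumes G: "is_game G" "\<alpha> \<in> controls G" "\<alpha>' \<in> controls G" "x \<in> paths G" "t \<in> time_set G"
    and \<tau>: "path_stopping_time G \<tau>" "t \<le> \<tau> x"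
    and eq: "\<And>i s y. y \<in> paths_from G t x \<Longrightarrow> t \<le> s \<Longrightarrow> s < \<tau> y \<Longrightarrow> \<alpha> i s y = \<alpha>' i s y"
    and \<psi>: "stopped_fun G \<tau> \<psi>"
  shows "stopped_cost G \<tau> \<psi> t x \<alpha> = stopped_cost G \<tau> \<psi> t x \<alpha>'"
proof -
  have "stopped_cost G \<tau> \<psi> t x \<alpha> $ i = stopped_cost G \<tau> \<psi> t x \<alpha>' $ i" for i
  proof -
    \<comment> \<open>The profile enters twice, through the law and through the running costs; it is
      a parameter of \<open>?h\<close> so that the two occurrences can be replaced one after the
      other.\<close>
    let ?h = "\<lambda>\<alpha> y. \<psi> y $ i + (\<Sum>s\<in>{t..<\<tau> y}. run_cost G i s y (\<alpha> i s y))"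
    have "stopped_fun G \<tau> (?h \<alpha>)"
      using \<psi> stopped_fun_run_cost[OF G(1,2) \<tau>(1), where t = t and i = i]
      unfolding stopped_fun_def by metis
    then have "mean G t x \<alpha> (?h \<alpha>) = mean G t x \<alpha>' (?h \<alpha>)"
      using eq by (intro mean_stopped_cong[OF G(1-3) \<tau>(1) G(4) \<tau>(2)])
    also have "\<dots> = mean G t x \<alpha>' (?h \<alpha>')"
      using eq by (intro mean_cong) (auto intro!: sum.cong)
    finally show ?thesis
      by (simp only: stopped_cost_mean[OF G(1,2,4,5)] stopped_cost_mean[OF G(1,3,4,5)])
  qed
  then show ?thesis by (simp add: vec_eq_iff)
qed

lemma stopped_cost_mono:
  assumes G: "is_game G" "\<alpha> \<in> controls G" "x \<in> paths G" "t \<in> time_set G"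
    and le: "\<And>y. y \<in> paths_from G t x \<Longrightarrow> \<psi> y $ i \<le> \<psi>' y $ i"
  shows "stopped_cost G \<tau> \<psi> t x \<alpha> $ i \<le> stopped_cost G \<tau> \<psi>' t x \<alpha> $ i"
  unfolding stopped_cost_mean[OF G] using le by (intro mean_mono[OF G(1,2)]) auto

lemma stopped_cost_strict_mono:
  assumes G: "is_game G" "\<alpha> \<in> controls G" "x \<in> paths G" "t \<in> time_set G"
    and le: "\<And>y. y \<in> paths_from G t x \<Longrightarrow> \<psi> y $ i \<le> \<psi>' y $ i"
    and z: "z \<in> paths_from G t x" "\<psi> z $ i < \<psi>' z $ i"
  shows "stopped_cost G \<tau> \<psi> t x \<alpha> $ i < stopped_cost G \<tau> \<psi>' t x \<alpha> $ i"
  unfolding stopped_cost_mean[OF G] using le z by (intro mean_strict_mono[OF G(1,2) _ z(1)]) auto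

lemma stopped_cost_cong:
  assumes G: "is_game G" "\<alpha> \<in> controls G" "x \<in> paths G" "t \<in> time_set G"
    and eq: "\<And>y. y \<in> paths_from G t x \<Longrightarrow> \<psi> y = \<psi>' y"
  shows "stopped_cost G \<tau> \<psi> t x \<alpha> = stopped_cost G \<tau> \<psi>' t x \<alpha>"
  unfolding vec_eq_iff stopped_cost_mean[OF G] using eq by (intro allI mean_cong) auto

section \<open>Switching control profiles at a stopping time\<close>

text \<open>At time \<open>\<tau> y\<close> itself \<gamma> is already in force, matching running
  costs that are summed strictly before \<open>\<tau>\<close>.\<close>

definition switch :: "((nat \<Rightarrow> 's) \<Rightarrow> nat) \<Rightarrow> ('n \<Rightarrow> nat \<Rightarrow> (nat \<Rightarrow> 's) \<Rightarrow> 'a) \<Rightarrow>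
    ((nat \<Rightarrow> 's) \<Rightarrow> 'n \<Rightarrow> nat \<Rightarrow> (nat \<Rightarrow> 's) \<Rightarrow> 'a) \<Rightarrow> 'n \<Rightarrow> nat \<Rightarrow> (nat \<Rightarrow> 's) \<Rightarrow> 'a" where
  "switch \<tau> \<alpha> \<gamma> = (\<lambda>i s y. if s < \<tau> y then \<alpha> i s y else \<gamma> y i s y)"

text \<open>Although \<gamma> is indexed by whole paths, it is consulted only once
  \<open>\<tau>\<close> has occurred, and its value is then determined by the path observed so
  far.\<close>

lemma switch_controls:
  assumes \<tau>: "path_stopping_time G \<tau>" and \<alpha>: "\<alpha> \<in> controls G"
    and \<gamma>: "stopped_fun G \<tau> \<gamma>" "\<And>y. y \<in> paths G \<Longrightarrow> \<gamma> y \<in> controls G"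
  shows "switch \<tau> \<alpha> \<gamma> \<in> controls G"
proof -
  have "switch \<tau> \<alpha> \<gamma> i s y \<in> ctrl_vals G i" if "s \<in> time_set G" "y \<in> paths G" for i s y
    using controls_vals[OF \<alpha> that] controls_vals[OF \<gamma>(2)[OF that(2)] that]
    by (auto simp: switch_def)
  moreover have "adapted G (switch \<tau> \<alpha> \<gamma> i)" for i
    unfolding adapted_def
  proof (intro ballI impI)
    fix s y z assume s: "s \<in> time_set G" and yz: "y \<in> paths G" "z \<in> paths G" "agree s y z"
    note \<tau>D = stopped_funD[of G \<tau> \<tau>] \<tau>[unfolded path_stopping_time_def]
    show "switch \<tau> \<alpha> \<gamma> i s y = switch \<tau> \<alpha> \<gamma> i s z"
    proof (cases "\<tau> y \<le> s")
      case True
      then have "agree (\<tau> y) y z" using agree_mono yz(3) by blast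
      then have "\<tau> z = \<tau> y" "\<gamma> z = \<gamma> y"
        using \<tau>D yz stopped_funD[OF \<gamma>(1)] by blast+
      then show ?thesis
        using True controlsD[OF \<gamma>(2)[OF yz(1)] s yz] by (simp add: switch_def)
    next
      case False
      \<comment> \<open>Whether \<open>\<tau>\<close> has occurred by time \<open>s\<close> can be
        read off the path up to \<open>s\<close>, so both paths are still in the first
        regime.\<close>
      have "\<not> \<tau> z \<le> s"
      proof
        assume "\<tau> z \<le> s"
        then have "agree (\<tau> z) z y" using agree_mono agree_sym yz(3) by blast
        then have "\<tau> y = \<tau> z" using \<tau>D yz by blast
        with False \<open>\<tau> z \<le> s\<close> show False by simp
      qed
      then show ?thesis
        using False controlsD[OF \<alpha> s yz] by (simp add: switch_def)
    qed
  qed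
  ultimately show ?thesis
    by (auto simp: controls_def player_controls_def)
qed

lemma cost_switch:
  assumes G: "is_game G" "\<alpha> \<in> controls G" "x \<in> paths G" "t \<in> time_set G"
    and \<tau>: "path_stopping_time G \<tau>" "t \<le> \<tau> x"
    and \<gamma>: "stopped_fun G \<tau> \<gamma>" "\<And>y. y \<in> paths G \<Longrightarrow> \<gamma> y \<in> controls G"
  shows "cost G t x (switch \<tau> \<alpha> \<gamma>) = stopped_cost G \<tau> (\<lambda>y. cost G (\<tau> y) y (\<gamma> y)) t x \<alpha>"
proof -
  let ?\<alpha> = "switch \<tau> \<alpha> \<gamma>"
  have ctrl: "?\<alpha> \<in> controls G" by (rule switch_controls[OF \<tau>(1) G(2) \<gamma>])
  \<comment> \<open>Every continuation of \<open>y\<close> after \<open>\<tau> y\<close> has the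
    same \<open>\<tau>\<close> and selects the same \<open>\<gamma> y\<close>, so the switched
    profile coincides with \<open>\<gamma> y\<close> there.\<close>
  have after: "cost G (\<tau> y) y ?\<alpha> = cost G (\<tau> y) y (\<gamma> y)" if y: "y \<in> paths G" for y
  proof (rule cost_controls_cong[OF G(1) ctrl \<gamma>(2)[OF y] y])
    show "\<tau> y \<in> time_set G" using \<tau>(1) y by (simp add: path_stopping_time_def)
    fix z i s assume z: "z \<in> paths_from G (\<tau> y) y" and s: "\<tau> y \<le> s"
    have "z \<in> paths G" "agree (\<tau> y) y z" using z by (auto simp: paths_from_def intro: agree_sym)
    then have "\<tau> z = \<tau> y" "\<gamma> z = \<gamma> y"
      using y \<tau>(1) stopped_funD[OF \<gamma>(1), of y z] stopped_funD[of G \<tau> \<tau> y z]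
      by (simp_all add: path_stopping_time_def)
    then show "?\<alpha> i s z = \<gamma> y i s z" using s by (simp add: switch_def)
  qed
  have stopped: "stopped_fun G \<tau> (\<lambda>y. cost G (\<tau> y) y (\<gamma> y))"
    by (rule stopped_fun_cost[OF G(1) \<tau>(1) \<gamma>])
  have "cost G t x ?\<alpha> = stopped_cost G \<tau> (\<lambda>y. cost G (\<tau> y) y ?\<alpha>) t x ?\<alpha>"
    by (rule cost_dynamic_programming[OF G(1) ctrl G(3,4) \<tau>])
  also have "\<dots> = stopped_cost G \<tau> (\<lambda>y. cost G (\<tau> y) y (\<gamma> y)) t x ?\<alpha>"
    by (rule stopped_cost_cong[OF G(1) ctrl G(3,4)]) (simp add: after paths_fromD)
  also have "\<dots> = stopped_cost G \<tau> (\<lambda>y. cost G (\<tau> y) y (\<gamma> y)) t x \<alpha>"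
    by (rule stopped_cost_controls_cong[OF G(1) ctrl G(2-4) \<tau> _ stopped])
      (simp add: switch_def)
  finally show ?thesis .
qed

section \<open>Restricting equilibria to, and gluing them at, a stopping time\<close>

text \<open>Allows any profile that differs from \<alpha> in one component, since deviations below
  arise as switched profiles and not as function updates.\<close>

lemma nashD:
  assumes "\<alpha> \<in> nash G t x" "\<alpha>' \<in> controls G" "\<And>j. j \<noteq> i \<Longrightarrow> \<alpha>' j = \<alpha> j"
  shows "cost G t x \<alpha> $ i \<le> cost G t x \<alpha>' $ i"
proof -
  have "\<alpha>' = \<alpha>(i := \<alpha>' i)" using assms(3) by auto
  moreover have "\<alpha>' i \<in> player_controls G i" using assms(2) by (auto simp: controls_def)
  ultimately show ?thesis using assms(1) unfolding nash_def by (metis (lifting) mem_Collect_eq)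
qed

text \<open>
  A deviation profitable after \<open>\<tau>\<close> on one path \<open>y\<close>, played only if \<open>y\<close> has been followed up to \<open>\<tau> y\<close>,
  would be profitable from the start, because that event has positive probability.
\<close>
lemma nash_at_stopping_time:
  assumes G: "is_game G" "x \<in> paths G" "t \<in> time_set G"
    and \<tau>: "path_stopping_time G \<tau>" "t \<le> \<tau> x"
    and nash: "\<alpha> \<in> nash G t x" and y: "y \<in> paths_from G t x"
  shows "\<alpha> \<in> nash G (\<tau> y) y"
proof -
  have \<alpha>: "\<alpha> \<in> controls G" using nash by (simp add: nash_def)
  have yp: "y \<in> paths G" "\<tau> y \<in> time_set G"
    using y \<tau>(1) by (auto simp: paths_from_def path_stopping_time_def)
  have "cost G (\<tau> y) y \<alpha> $ i \<le> cost G (\<tau> y) y (\<alpha>(i := \<beta>)) $ i"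
    if \<beta>: "\<beta> \<in> player_controls G i" for i \<beta>
  proof (rule ccontr)
    assume less: "\<not> ?thesis"
    let ?\<beta> = "\<alpha>(i := \<beta>)"
    have \<beta>c: "?\<beta> \<in> controls G" by (rule controls_fun_upd[OF \<alpha> \<beta>])
    \<comment> \<open>The deviation is confined to the paths sharing the history of \<open>y\<close>
      up to \<open>\<tau> y\<close>. Since \<open>\<tau>\<close> is constant on this class,
      membership is known at \<open>\<tau>\<close>, which makes \<gamma> a
      \<open>stopped_fun\<close>.\<close>
    define \<gamma> where "\<gamma> z = (if agree (\<tau> y) z y then ?\<beta> else \<alpha>)" for z
    have \<gamma>c: "\<gamma> z \<in> controls G" for z using \<alpha> \<beta>c by (simp add: \<gamma>_def)
    have \<gamma>s: "stopped_fun G \<tau> \<gamma>"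
      unfolding stopped_fun_def
    proof (intro ballI impI)
      fix z w assume zw: "z \<in> paths G" "w \<in> paths G" "agree (\<tau> z) z w"
      have \<tau>D: "\<tau> v = \<tau> u" if "u \<in> paths G" "v \<in> paths G" "agree (\<tau> u) u v" for u v
        using that \<tau>(1) stopped_funD[of G \<tau> \<tau> u v] by (simp add: path_stopping_time_def)
      have "agree (\<tau> y) z y \<longleftrightarrow> agree (\<tau> y) w y"
        using \<tau>D[OF zw] \<tau>D[OF yp(1) zw(1)] \<tau>D[OF yp(1) zw(2)] zw(3)
        by (metis agree_sym agree_trans)
      then show "\<gamma> w = \<gamma> z" by (simp add: \<gamma>_def)
    qed
    have le: "cost G (\<tau> z) z (\<gamma> z) $ i \<le> cost G (\<tau> z) z \<alpha> $ i" if z: "z \<in> paths G" for z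
    proof (cases "agree (\<tau> y) z y")
      case True
      then have "\<tau> z = \<tau> y"
        using z yp \<tau>(1) agree_sym[OF True] stopped_funD[of G \<tau> \<tau> y z]
        by (simp add: path_stopping_time_def)
      then show ?thesis
        using True less cost_agree[OF G(1) _ z yp True] \<alpha> \<beta>c by (simp add: \<gamma>_def)
    qed (simp add: \<gamma>_def)
    \<comment> \<open>By \<open>le\<close> the continuation costs never increase, and at
      \<open>y\<close> they drop strictly; the positive weight of \<open>y\<close> carries the drop
      back to time \<open>t\<close>.\<close>
    have "cost G t x (switch \<tau> \<alpha> \<gamma>) $ i < cost G t x \<alpha> $ i"
      unfolding cost_switch[OF G(1) \<alpha> G(2,3) \<tau> \<gamma>s \<gamma>c]
        cost_dynamic_programming[OF G(1) \<alpha> G(2,3) \<tau>]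
      by (rule stopped_cost_strict_mono[OF G(1) \<alpha> G(2,3) _ y])
        (use le less in \<open>auto simp: \<gamma>_def paths_fromD\<close>)
    moreover have "cost G t x \<alpha> $ i \<le> cost G t x (switch \<tau> \<alpha> \<gamma>) $ i"
      by (rule nashD[OF nash switch_controls[OF \<tau>(1) \<alpha> \<gamma>s \<gamma>c]])
        (auto simp: switch_def \<gamma>_def fun_eq_iff)
    ultimately show False by simp
  qed
  then show ?thesis using \<alpha> by (simp add: nash_def)
qed

text \<open>A deviation in the stopped game is imitated in the full game by playing it before
  \<open>\<tau>\<close> and returning to \<alpha> at \<open>\<tau>\<close>, which reproduces the
  prescribed terminal value.\<close>

lemma stopped_nash_of_nash:
  assumes G: "is_game G" "x \<in> paths G" "t \<in> time_set G"
    and \<tau>: "path_stopping_time G \<tau>" "t \<le> \<tau> x"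
    and nash: "\<alpha> \<in> nash G t x"
  shows "\<alpha> \<in> stopped_nash G \<tau> (\<lambda>y. cost G (\<tau> y) y \<alpha>) t x"
proof -
  let ?\<psi> = "\<lambda>y. cost G (\<tau> y) y \<alpha>"
  have \<alpha>: "\<alpha> \<in> controls G" using nash by (simp add: nash_def)
  have const: "stopped_fun G \<tau> (\<lambda>_. \<alpha>)" by (simp add: stopped_fun_def)
  have "stopped_cost G \<tau> ?\<psi> t x \<alpha> $ i \<le> stopped_cost G \<tau> ?\<psi> t x (\<alpha>(i := \<beta>)) $ i"
    if \<beta>: "\<beta> \<in> player_controls G i" for i \<beta>
  proof -
    have \<beta>c: "\<alpha>(i := \<beta>) \<in> controls G" by (rule controls_fun_upd[OF \<alpha> \<beta>])
    have "cost G t x \<alpha> $ i \<le> cost G t x (switch \<tau> (\<alpha>(i := \<beta>)) (\<lambda>_. \<alpha>)) $ i"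
      by (rule nashD[OF nash switch_controls[OF \<tau>(1) \<beta>c const \<alpha>]]) (auto simp: switch_def fun_eq_iff)
    then show ?thesis
      by (simp only: cost_switch[OF G(1) \<beta>c G(2,3) \<tau> const \<alpha>]
          cost_dynamic_programming[OF G(1) \<alpha> G(2,3) \<tau>])
  qed
  then show ?thesis using \<alpha> by (simp add: stopped_nash_def)
qed

text \<open>A deviation of one player splits at \<open>\<tau>\<close>. Before \<open>\<tau>\<close>
  it cannot help for fixed terminal values, by the stopped equilibrium; from \<open>\<tau>\<close>
  on it can only raise the continuation costs, and stopped costs are monotone in these.\<close>

lemma nash_switch:
  assumes G: "is_game G" "x \<in> paths G" "t \<in> time_set G"
    and \<tau>: "path_stopping_time G \<tau>" "t \<le> \<tau> x"
    and \<gamma>: "stopped_fun G \<tau> \<gamma>" "\<And>y. y \<in> paths G \<Longrightarrow> \<gamma> y \<in> controls G"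
    and nash: "\<And>y. y \<in> paths_from G t x \<Longrightarrow> \<gamma> y \<in> nash G (\<tau> y) y"
    and stopped: "\<alpha> \<in> stopped_nash G \<tau> (\<lambda>y. cost G (\<tau> y) y (\<gamma> y)) t x"
  shows "switch \<tau> \<alpha> \<gamma> \<in> nash G t x"
proof -
  let ?\<psi> = "\<lambda>y. cost G (\<tau> y) y (\<gamma> y)"
  have \<alpha>: "\<alpha> \<in> controls G" using stopped by (simp add: stopped_nash_def)
  have "cost G t x (switch \<tau> \<alpha> \<gamma>) $ i \<le> cost G t x ((switch \<tau> \<alpha> \<gamma>)(i := \<beta>)) $ i"
    if \<beta>: "\<beta> \<in> player_controls G i" for i \<beta>
  proof -
    have \<beta>c: "\<alpha>(i := \<beta>) \<in> controls G" by (rule controls_fun_upd[OF \<alpha> \<beta>])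
    let ?\<gamma> = "\<lambda>y. (\<gamma> y)(i := \<beta>)"
    have \<gamma>s: "stopped_fun G \<tau> ?\<gamma>" using \<gamma>(1) unfolding stopped_fun_def by metis
    have \<gamma>c: "?\<gamma> y \<in> controls G" if "y \<in> paths G" for y
      by (rule controls_fun_upd[OF \<gamma>(2)[OF that] \<beta>])
    have "cost G t x (switch \<tau> \<alpha> \<gamma>) $ i = stopped_cost G \<tau> ?\<psi> t x \<alpha> $ i"
      by (simp only: cost_switch[OF G(1) \<alpha> G(2,3) \<tau> \<gamma>])
    also have "\<dots> \<le> stopped_cost G \<tau> ?\<psi> t x (\<alpha>(i := \<beta>)) $ i"
      using stopped \<beta> by (simp add: stopped_nash_def)
    also have "\<dots> \<le> stopped_cost G \<tau> (\<lambda>y. cost G (\<tau> y) y (?\<gamma> y)) t x (\<alpha>(i := \<beta>)) $ i"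
      using nash \<beta> by (intro stopped_cost_mono[OF G(1) \<beta>c G(2,3)]) (simp add: nash_def)
    also have "\<dots> = cost G t x (switch \<tau> (\<alpha>(i := \<beta>)) ?\<gamma>) $ i"
      by (simp only: cost_switch[OF G(1) \<beta>c G(2,3) \<tau> \<gamma>s \<gamma>c])
    \<comment> \<open>Replacing one player's control commutes with switching, so the bound concerns
      the original deviation.\<close>
    also have "switch \<tau> (\<alpha>(i := \<beta>)) ?\<gamma> = (switch \<tau> \<alpha> \<gamma>)(i := \<beta>)"
      by (auto simp: switch_def fun_eq_iff)
    finally show ?thesis .
  qed
  then show ?thesis
    using switch_controls[OF \<tau>(1) \<alpha> \<gamma>] by (simp add: nash_def)
qed

section \<open>The two inclusions, with a selection of continuation equilibria\<close>

theorem theorem2p8: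
  fixes G :: "('s, 'a, 'n::finite) game"
    and t :: nat
    and x :: "nat \<Rightarrow> 's"
    and \<tau> :: "(nat \<Rightarrow> 's) \<Rightarrow> nat"
  assumes "is_game G"
    and "t \<in> time_set G"
    and "x \<in> paths G"
    and "game_stopping_time G \<tau>"
    and "t < \<tau> x"
  shows "set_value G t x =
    {stopped_cost G \<tau> \<psi> t x \<alpha> | \<psi> \<alpha>.
       \<psi> \<in> borel_measurable (stopped_sigma G \<tau>) \<and>
       (\<forall>y\<in>paths_from G t x. \<psi> y \<in> set_value G (\<tau> y) y) \<and>
       \<alpha> \<in> stopped_nash G \<tau> \<psi> t x}"
    (is "_ = ?R")
proof
  note G = assms(1,3,2)
  note \<tau> = game_stopping_time_path[OF assms(4)] less_imp_le[OF assms(5)]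
  note meas = stopped_measurable_iff[OF assms(1,4)]
  show "set_value G t x \<subseteq> ?R"
  proof
    fix v assume "v \<in> set_value G t x"
    then obtain \<alpha> where \<alpha>: "\<alpha> \<in> nash G t x" and v: "v = cost G t x \<alpha>"
      by (auto simp: set_value_def)
    let ?\<psi> = "\<lambda>y. cost G (\<tau> y) y \<alpha>"
    have \<alpha>c: "\<alpha> \<in> controls G" using \<alpha> by (simp add: nash_def)
    have const: "stopped_fun G \<tau> (\<lambda>_. \<alpha>)" by (simp add: stopped_fun_def)
    have "?\<psi> \<in> borel_measurable (stopped_sigma G \<tau>)"
      unfolding meas by (rule stopped_fun_cost[OF G(1) \<tau>(1) const \<alpha>c])
    moreover have "\<forall>y\<in>paths_from G t x. ?\<psi> y \<in> set_value G (\<tau> y) y"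
      using nash_at_stopping_time[OF G \<tau> \<alpha>] by (auto simp: set_value_def)
    moreover have "\<alpha> \<in> stopped_nash G \<tau> ?\<psi> t x"
      by (rule stopped_nash_of_nash[OF G \<tau> \<alpha>])
    moreover have "v = stopped_cost G \<tau> ?\<psi> t x \<alpha>"
      unfolding v by (rule cost_dynamic_programming[OF G(1) \<alpha>c G(2,3) \<tau>])
    ultimately show "v \<in> ?R" by blast
  qed
  show "?R \<subseteq> set_value G t x"
  proof
    fix v assume "v \<in> ?R"
    then obtain \<psi> \<alpha> where \<psi>: "stopped_fun G \<tau> \<psi>"
      and val: "\<And>y. y \<in> paths_from G t x \<Longrightarrow> \<psi> y \<in> set_value G (\<tau> y) y"
      and \<alpha>: "\<alpha> \<in> stopped_nash G \<tau> \<psi> t x" and v: "v = stopped_cost G \<tau> \<psi> t x \<alpha>"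
      unfolding meas by blast
    have \<alpha>c: "\<alpha> \<in> controls G" using \<alpha> by (simp add: stopped_nash_def)
    \<comment> \<open>\<open>S y\<close> collects the continuation equilibria at
      \<open>(\<tau> y, y)\<close> with value \<open>\<psi> y\<close>. It may be empty for paths
      outside \<open>paths_from G t x\<close>, where \<alpha> serves as an arbitrary admissible
      default.\<close>
    define S where "S y = {\<gamma> \<in> nash G (\<tau> y) y. \<psi> y = cost G (\<tau> y) y \<gamma>}" for y
    define \<gamma> where "\<gamma> y = (if S y = {} then \<alpha> else SOME \<gamma>. \<gamma> \<in> S y)" for y
    have sel: "\<gamma> y \<in> S y" if "S y \<noteq> {}" for y
      using that some_in_eq[of "S y"] by (simp add: \<gamma>_def)
    have \<gamma>c: "\<gamma> y \<in> controls G" for y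
      using \<alpha>c sel[of y] by (cases "S y = {}") (auto simp: \<gamma>_def S_def nash_def)
    \<comment> \<open>The choice depends on \<open>y\<close> only through the set
      \<open>S y\<close>; equal sets for paths agreeing up to \<open>\<tau>\<close> therefore make
      the selection \<gamma> a \<open>stopped_fun\<close>.\<close>
    have S_eq: "S z = S y" if yz: "y \<in> paths G" "z \<in> paths G" "agree (\<tau> y) y z" for y z
    proof -
      have eq: "\<tau> z = \<tau> y" "\<tau> y \<in> time_set G" "\<psi> z = \<psi> y"
        using \<tau>(1) yz stopped_funD[of G \<tau> \<tau> y z] stopped_funD[OF \<psi> yz]
        by (simp_all add: path_stopping_time_def)
      have "cost G (\<tau> y) y \<gamma> = cost G (\<tau> y) z \<gamma>" if "\<gamma> \<in> nash G (\<tau> y) z" for \<gamma>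
        using that eq(2) yz by (intro cost_agree[OF G(1)]) (auto simp: nash_def)
      then show ?thesis
        using nash_agree[OF G(1) yz(1,2) eq(2) yz(3)] by (auto simp: S_def eq)
    qed
    have \<gamma>s: "stopped_fun G \<tau> \<gamma>"
      unfolding stopped_fun_def
    proof (intro ballI impI)
      fix y z assume "y \<in> paths G" "z \<in> paths G" "agree (\<tau> y) y z"
      then have "S z = S y" by (rule S_eq)
      then show "\<gamma> z = \<gamma> y" by (simp add: \<gamma>_def)
    qed
    have *: "\<gamma> y \<in> nash G (\<tau> y) y" "cost G (\<tau> y) y (\<gamma> y) = \<psi> y" if "y \<in> paths_from G t x" for y
    proof -
      have "S y \<noteq> {}" using val[OF that] by (auto simp: S_def set_value_def)
      from sel[OF this] show "\<gamma> y \<in> nash G (\<tau> y) y" "cost G (\<tau> y) y (\<gamma> y) = \<psi> y"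
        by (simp_all add: S_def)
    qed
    \<comment> \<open>The selected continuation costs are known to equal \<psi> only on
      \<open>paths_from G t x\<close>, but stopped costs from \<open>(t, x)\<close> read no other
      paths.\<close>
    let ?\<psi> = "\<lambda>y. cost G (\<tau> y) y (\<gamma> y)"
    have stop: "stopped_cost G \<tau> ?\<psi> t x \<beta> = stopped_cost G \<tau> \<psi> t x \<beta>" if "\<beta> \<in> controls G" for \<beta>
      by (rule stopped_cost_cong[OF G(1) that G(2,3) *(2)])
    have stopped: "\<alpha> \<in> stopped_nash G \<tau> ?\<psi> t x"
      using \<alpha> stop[OF \<alpha>c] stop[OF controls_fun_upd[OF \<alpha>c]] by (simp add: stopped_nash_def)
    have "switch \<tau> \<alpha> \<gamma> \<in> nash G t x"
      by (rule nash_switch[OF G \<tau> \<gamma>s \<gamma>c *(1) stopped])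
    moreover have "v = cost G t x (switch \<tau> \<alpha> \<gamma>)"
      unfolding v cost_switch[OF G(1) \<alpha>c G(2,3) \<tau> \<gamma>s \<gamma>c] stop[OF \<alpha>c] ..
    ultimately show "v \<in> set_value G t x" by (auto simp: set_value_def)
  qed
qed

end
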